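(* Let $S=k[x_1,\ldots,x_n]$ be a polynomial ring over a field $k$ and $q\ge2$. Let $I=(L^f(u))\subset S$ be the final squarefree lexsegment ideal determined by the monomial $u=x_1x_{i_2}\cdots x_{i_q}$, $2\leq i_2<\cdots<i_q\leq n$, $u\neq x_1x_2\cdots x_q$. Let $F=\{i_2,\ldots,i_q\}$ and let $\Delta$ be the simplicial complex with Stanley–Reisner ideal $I$. Then: (a) $\dim(S/I)=q$. (b) $\mathrm{depth}(S/I)=q-1$. (c) The multiplicity of $k[\Delta]$ is $e(k[\Delta])=|\{x_G: G\subset[n],\ |G|=n-q,\ x_{F^c\setminus\{1\}}>_{lex}x_G\}|$.
   Context: Monomials are ordered by the lexicographic order with $x_1>x_2>\cdots>x_n$. For a squarefree monomial $u$ of degree $q$, $L^f(u)=\{w: w\text{ a squarefree monomial of degree }q,\ u\geq_{lex}w\}$. For $G\subset[n]=\{1,\ldots,n\}$, $x_G=\prod_{i\in G}x_i$ and $G^c=[n]\setminus G$. The Stanley–Reisner ideal of $\Delta$ is generated by the $x_G$ with $G\notin\Delta$, and $k[\Delta]=S/I$. Depth is taken with respect to $(x_1,\ldots,x_n)$; $e(k[\Delta])$ is the (Hilbert–Samuel) multiplicity, which equals the number of facets of $\Delta$ of maximal dimension. *)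

theory Defs
  imports "HOL-Library.Poly_Mapping" "HOL-Library.Extended_Nat" "HOL-Algebra.Algebra" Complex_Main
begin

section \<open>Invariants of commutative rings\<close>

text \<open>The supremum is taken in the extended naturals, so the dimension may be infinite.
  The zero ring has no prime ideals and gets dimension 0.\<close>

definition krull_dim :: "('a, 'b) ring_scheme \<Rightarrow> enat" where
  "krull_dim R = Sup {enat l | l. \<exists>P :: nat \<Rightarrow> 'a set.
     (\<forall>i\<le>l. primeideal (P i) R) \<and> (\<forall>i<l. P i \<subset> P (Suc i))}"

text \<open>In a regular sequence, each entry is a nonzerodivisor modulo the ideal generated by the
  previous ones, and the ideal generated by all of them is proper.\<close>

definition regular_sequence :: "('a, 'b) ring_scheme \<Rightarrow> 'a list \<Rightarrow> bool" where
  "regular_sequence R fs \<longleftrightarrow>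
     set fs \<subseteq> carrier R \<and>
     (\<forall>i<length fs. \<forall>a\<in>carrier R.
        fs ! i \<otimes>\<^bsub>R\<^esub> a \<in> Idl\<^bsub>R\<^esub> (set (take i fs)) \<longrightarrow> a \<in> Idl\<^bsub>R\<^esub> (set (take i fs))) \<and>
     Idl\<^bsub>R\<^esub> (set fs) \<noteq> carrier R"

definition depth :: "('a, 'b) ring_scheme \<Rightarrow> 'a set \<Rightarrow> enat" where
  "depth R J = Sup {enat (length fs) | fs. set fs \<subseteq> J \<and> regular_sequence R fs}"

text \<open>The length of a ring as a module over itself, whose submodules are the ideals.\<close>

definition ring_length :: "('a, 'b) ring_scheme \<Rightarrow> enat" where
  "ring_length R = Sup {enat l | l. \<exists>H :: nat \<Rightarrow> 'a set.
     (\<forall>i\<le>l. ideal (H i) R) \<and> (\<forall>i<l. H i \<subset> H (Suc i))}"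

primrec ideal_power :: "('a, 'b) ring_scheme \<Rightarrow> 'a set \<Rightarrow> nat \<Rightarrow> 'a set" where
  "ideal_power R J 0 = carrier R"
| "ideal_power R J (Suc t) = ideal_prod R (ideal_power R J t) J"

text \<open>The Hilbert--Samuel multiplicity of \<open>R\<close> with respect to \<open>J\<close>: the limit of
  \<open>d! \<ell>(R/J\<^sup>t) / t\<^sup>d\<close>, where \<open>d = dim R\<close>. The \<open>R\<close>-submodules of \<open>R/J\<^sup>t\<close> are the ideals of the
  quotient ring, so \<open>\<ell>(R/J\<^sup>t)\<close> is the length of that ring. The value is meaningful if
  \<open>d\<close> and these lengths are finite.\<close>

definition hs_multiplicity :: "('a, 'b) ring_scheme \<Rightarrow> 'a set \<Rightarrow> real" where
  "hs_multiplicity R J =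
     (let d = the_enat (krull_dim R)
      in lim (\<lambda>t. fact d * real (the_enat (ring_length (R Quot ideal_power R J t))) / real t ^ d))"


section \<open>Polynomials\<close>

text \<open>A monomial is its exponent vector. The linear order that the library puts on
  \<^typ>\<open>nat \<Rightarrow>\<^sub>0 nat\<close> compares two vectors at the least index where they differ, so on monomials it
  is the lexicographic order with \<open>x\<^sub>1 > x\<^sub>2 > \<dots>\<close>; see \<open>less_monom_iff\<close> below.\<close>

type_synonym monom = "nat \<Rightarrow>\<^sub>0 nat"

lemma less_monom_iff:
  fixes v w :: monom
  shows "v < w \<longleftrightarrow> (\<exists>i. Poly_Mapping.lookup v i < Poly_Mapping.lookup w i \<and>
           (\<forall>j<i. Poly_Mapping.lookup v j = Poly_Mapping.lookup w j))"
  by (simp add: less_poly_mapping.rep_eq less_fun_def)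

definition var_monom :: "nat \<Rightarrow> monom" where
  "var_monom i = Poly_Mapping.single i 1"

definition set_monom :: "nat set \<Rightarrow> monom" where
  "set_monom G = (\<Sum>i\<in>G. var_monom i)"

definition squarefree_monoms :: "nat \<Rightarrow> nat \<Rightarrow> monom set" where
  "squarefree_monoms n q = {w. Poly_Mapping.keys w \<subseteq> {1..n} \<and>
     (\<forall>i. Poly_Mapping.lookup w i \<le> 1) \<and> (\<Sum>i\<in>{1..n}. Poly_Mapping.lookup w i) = q}"

definition final_lexsegment :: "nat \<Rightarrow> nat \<Rightarrow> monom \<Rightarrow> monom set" where
  "final_lexsegment n q u = {w \<in> squarefree_monoms n q. u \<ge> w}"

type_synonym 'k mpoly = "monom \<Rightarrow>\<^sub>0 'k"

definition monom_poly :: "monom \<Rightarrow> 'k::field mpoly" where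
  "monom_poly w = Poly_Mapping.single w 1"

definition polynomial_ring :: "nat \<Rightarrow> 'k::field mpoly ring" where
  "polynomial_ring n =
     \<lparr>carrier = {p. \<forall>w\<in>Poly_Mapping.keys p. Poly_Mapping.keys w \<subseteq> {1..n}},
      monoid.mult = (*), one = 1, ring.zero = 0, ring.add = (+)\<rparr>"

lemma cring_polynomial_ring: "cring (polynomial_ring n :: 'k::field mpoly ring)"
proof -
  let ?C = "{p :: 'k mpoly. \<forall>w\<in>Poly_Mapping.keys p. Poly_Mapping.keys w \<subseteq> {1..n}}"
  have add: "p + q \<in> ?C" if "p \<in> ?C" "q \<in> ?C" for p q
    using that Poly_Mapping.keys_add[of p q] by blast
  have mult: "p * q \<in> ?C" if "p \<in> ?C" "q \<in> ?C" for p q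
  proof -
    have "Poly_Mapping.keys w \<subseteq> {1..n}" if w: "w \<in> Poly_Mapping.keys (p * q)" for w
    proof -
      obtain a b where "w = a + b" "a \<in> Poly_Mapping.keys p" "b \<in> Poly_Mapping.keys q"
        using w keys_mult[of p q] by blast
      then show ?thesis
        using \<open>p \<in> ?C\<close> \<open>q \<in> ?C\<close> Poly_Mapping.keys_add[of a b] by blast
    qed
    then show ?thesis by blast
  qed
  have uminus: "- p \<in> ?C" if "p \<in> ?C" for p
  proof -
    have "Poly_Mapping.keys (- p) = Poly_Mapping.keys p"
      by (simp add: set_eq_iff in_keys_iff)
    with that show ?thesis by simp
  qed
  have zero: "0 \<in> ?C" and one: "1 \<in> ?C"
    by simp_all
  show ?thesis
    unfolding polynomial_ring_def
  proof (rule cringI)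
    let ?R = "\<lparr>carrier = ?C, monoid.mult = (*), one = 1, ring.zero = 0, ring.add = (+)\<rparr>"
    show "abelian_group ?R"
    proof (rule abelian_groupI, unfold ring_record_simps)
      fix p assume "p \<in> ?C"
      then show "\<exists>q\<in>?C. q + p = 0"
        using uminus by (intro bexI[of _ "- p"]) simp_all
    qed (rule add zero add.assoc add.commute add_0_left; assumption)+
    show "comm_monoid ?R"
      by (rule comm_monoidI, unfold ring_record_simps)
        (rule mult one mult.assoc mult.commute mult_1_left; assumption)+
  qed (simp only: ring_record_simps distrib_right)
qed

text \<open>The ideal generated by the residue classes of \<open>x\<^sub>1, \<dots>, x\<^sub>n\<close> in \<open>S/I\<close>.\<close>

definition irrelevant_ideal :: "nat \<Rightarrow> 'k::field mpoly set \<Rightarrow> 'k mpoly set set" where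
  "irrelevant_ideal n I =
     Idl\<^bsub>polynomial_ring n Quot I\<^esub> ((\<lambda>i. I +>\<^bsub>polynomial_ring n\<^esub> monom_poly (var_monom i)) ` {1..n})"


section \<open>Stanley--Reisner rings\<close>

definition simplicial_complex :: "nat \<Rightarrow> nat set set \<Rightarrow> bool" where
  "simplicial_complex n \<Delta> \<longleftrightarrow> \<Delta> \<subseteq> Pow {1..n} \<and> (\<forall>A\<in>\<Delta>. \<forall>B\<subseteq>A. B \<in> \<Delta>)"

definition stanley_reisner_ideal :: "nat \<Rightarrow> nat set set \<Rightarrow> 'k::field mpoly set" where
  "stanley_reisner_ideal n \<Delta> =
     Idl\<^bsub>polynomial_ring n\<^esub> {monom_poly (set_monom G) | G. G \<subseteq> {1..n} \<and> G \<notin> \<Delta>}"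

definition stanley_reisner_ring :: "nat \<Rightarrow> nat set set \<Rightarrow> 'k::field mpoly set ring" where
  "stanley_reisner_ring n \<Delta> = polynomial_ring n Quot stanley_reisner_ideal n \<Delta>"

end

theory Submission
  imports Defs
begin

text \<open>
  Let \<open>U = {1} \<union> F\<close> be the support of \<open>u\<close>. The ideal \<open>I\<close> is spanned by the monomials whose support
  is not a face of the complex \<open>\<Gamma>\<close> of all \<open>G \<subseteq> [n]\<close> such that every \<open>q\<close>-element subset \<open>H\<close> of
  \<open>G\<close> satisfies \<open>x\<^sub>H > u\<close>. A \<open>q\<close>-element set that avoids \<open>1\<close> is smaller than \<open>U\<close>, so faces have at
  most \<open>q\<close> elements; all sets with fewer than \<open>q\<close> elements are faces; \<open>[q]\<close> is a face because
  \<open>U \<noteq> [q]\<close>; and \<open>F\<close> is a facet with \<open>q - 1\<close> elements.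

  Both upper bounds come from one fact: more than \<open>m\<close> polynomials in \<open>m\<close> variables satisfy a
  nontrivial algebraic relation (\<open>algebraic_relation\<close>, by counting monomials). Dividing such a
  relation by powers of its first entry and then setting this entry to zero removes the entries one
  by one (\<open>relation_descends\<close>). Applied to elements \<open>f\<^sub>i \<in> P\<^sub>i\<^sub>+\<^sub>1 - P\<^sub>i\<close> of a chain of primes, this
  bounds the length of the chain by the number of vertices of a face. Applied to a regular sequence
  it yields the bound on the depth: the monomial \<open>x\<^sub>F\<close> is killed by all variables outside \<open>F\<close>, so
  \<open>q\<close> elements of a regular sequence satisfy a relation that kills \<open>x\<^sub>F\<close>, and then \<open>x\<^sub>F\<close> lies in
  the ideal generated by them. Since the powers of a regular sequence are regular
  (\<open>weakly_regular_powers\<close>), \<open>x\<^sub>F\<close> even lies in an ideal generated in degrees at least \<open>q\<close>, which is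
  impossible for a monomial of degree \<open>q - 1\<close>.

  For the lower bound on the depth, the elementary symmetric polynomials
  \<open>e\<^sub>q\<^sub>-\<^sub>1, \<dots>, e\<^sub>1\<close> form a regular sequence (\<open>weakly_regular_esyms_complex\<close>). The exact sequence
  \<open>0 \<rightarrow> S/(I : x) \<rightarrow> S/I \<rightarrow> S/(I + xS) \<rightarrow> 0\<close> for monomials \<open>x\<close> (\<open>weakly_regular_extension\<close>) reduces
  this to simplices with \<open>q - 1\<close> or \<open>q\<close> vertices. No genericity is involved, so the field may be
  finite.

  For the multiplicity, the length of \<open>R/J\<^sup>t\<close> is the number of monomials of degree less than \<open>t\<close>
  whose support is a face. A face \<open>G\<close> contributes \<open>t - 1\<close> choose \<open>|G|\<close> of them, so the limit counts
  the faces with \<open>q\<close> elements, and complementation turns these into the sets in the statement.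
\<close>

section \<open>Regular sequences and algebraic relations\<close>

definition list_power :: "'a::comm_ring_1 list \<Rightarrow> nat list \<Rightarrow> 'a" where
  "list_power fs as = prod_list (map2 (^) fs as)"

lemma list_power_Nil: "list_power [] as = 1"
  by (simp add: list_power_def)

lemma list_power_Cons: "list_power (f # fs) (a # as) = f ^ a * list_power fs as"
  by (simp add: list_power_def)

text \<open>The polynomials in \<open>x\<^sub>1, \<dots>, x\<^sub>n\<close> are a subring of the type of all polynomials. Treating rings as
  subrings of a type of class \<^class>\<open>comm_ring_1\<close> keeps the arithmetic of the class available.\<close>

locale subring_carrier =
  fixes C :: "'a::comm_ring_1 set"
  assumes zero_closed: "0 \<in> C" and one_closed: "1 \<in> C"
    and add_closed: "a \<in> C \<Longrightarrow> b \<in> C \<Longrightarrow> a + b \<in> C"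
    and uminus_closed: "a \<in> C \<Longrightarrow> - a \<in> C"
    and mult_closed: "a \<in> C \<Longrightarrow> b \<in> C \<Longrightarrow> a * b \<in> C"
begin

lemma diff_closed: "a \<in> C \<Longrightarrow> b \<in> C \<Longrightarrow> a - b \<in> C"
  using add_closed[of a "- b"] uminus_closed by simp

lemma power_closed: "a \<in> C \<Longrightarrow> a ^ k \<in> C"
  by (induction k) (auto intro: one_closed mult_closed)

lemma sum_closed: "(\<And>x. x \<in> Y \<Longrightarrow> f x \<in> C) \<Longrightarrow> sum f Y \<in> C"
  by (induction Y rule: infinite_finite_induct) (auto intro: zero_closed add_closed)

lemmas closed = zero_closed one_closed add_closed uminus_closed mult_closed diff_closed
  power_closed sum_closed

definition ideal_in :: "'a set \<Rightarrow> bool" where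
  "ideal_in K \<longleftrightarrow> K \<subseteq> C \<and> 0 \<in> K \<and> (\<forall>a\<in>K. \<forall>b\<in>K. a + b \<in> K) \<and> (\<forall>c\<in>C. \<forall>a\<in>K. c * a \<in> K)"

lemma ideal_inD:
  assumes "ideal_in K"
  shows "a \<in> K \<Longrightarrow> a \<in> C" "0 \<in> K" "a \<in> K \<Longrightarrow> b \<in> K \<Longrightarrow> a + b \<in> K"
    "c \<in> C \<Longrightarrow> a \<in> K \<Longrightarrow> c * a \<in> K" "c \<in> C \<Longrightarrow> a \<in> K \<Longrightarrow> a * c \<in> K"
    "a \<in> K \<Longrightarrow> - a \<in> K" "a \<in> K \<Longrightarrow> b \<in> K \<Longrightarrow> a - b \<in> K"
proof -
  show neg: "- a \<in> K" if "a \<in> K" for a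
  proof -
    have "(- 1) * a \<in> K" using assms that closed unfolding ideal_in_def by blast
    thus ?thesis by simp
  qed
  show "a - b \<in> K" if "a \<in> K" "b \<in> K"
    using assms that neg[of b] unfolding ideal_in_def by (metis diff_conv_add_uminus)
qed (use assms in \<open>auto simp: ideal_in_def mult.commute\<close>)

definition adjoin :: "'a set \<Rightarrow> 'a \<Rightarrow> 'a set" where
  "adjoin K f = {a + f * c | a c. a \<in> K \<and> c \<in> C}"

lemma adjoinI: "a \<in> K \<Longrightarrow> c \<in> C \<Longrightarrow> a + f * c \<in> adjoin K f"
  by (auto simp: adjoin_def)

lemma adjoinE:
  assumes "b \<in> adjoin K f" obtains a c where "a \<in> K" "c \<in> C" "b = a + f * c"
  using assms by (auto simp: adjoin_def)

lemma ideal_in_adjoin: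
  assumes "ideal_in K" "f \<in> C"
  shows "ideal_in (adjoin K f)"
proof -
  have "a + b \<in> adjoin K f" if ab: "a \<in> adjoin K f" "b \<in> adjoin K f" for a b
  proof -
    from ab obtain a0 a1 b0 b1 where "a0 \<in> K" "a1 \<in> C" "b0 \<in> K" "b1 \<in> C"
      "a = a0 + f * a1" "b = b0 + f * b1" by (elim adjoinE)
    thus ?thesis using adjoinI[of "a0 + b0" K "a1 + b1" f] ideal_inD(3)[OF assms(1)] add_closed
      by (simp add: algebra_simps)
  qed
  moreover have "c * a \<in> adjoin K f" if c: "c \<in> C" "a \<in> adjoin K f" for c a
  proof -
    from c obtain a0 a1 where "a0 \<in> K" "a1 \<in> C" "a = a0 + f * a1" by (elim adjoinE)
    hence "c * a0 \<in> K" "c * a1 \<in> C" "c * a = c * a0 + f * (c * a1)"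
      using ideal_inD(4)[OF assms(1)] mult_closed c by (simp_all add: distrib_left mult_ac(3))
    thus ?thesis using adjoinI by metis
  qed
  moreover have "adjoin K f \<subseteq> C"
    using assms closed by (auto elim!: adjoinE dest: ideal_inD(1))
  moreover have "0 \<in> adjoin K f"
    using adjoinI[of 0 K 0 f] ideal_inD(2)[OF assms(1)] zero_closed by simp
  ultimately show ?thesis unfolding ideal_in_def by blast
qed

lemma subset_adjoin: "K \<subseteq> adjoin K f"
  using adjoinI[of _ K 0 f] zero_closed by auto

lemma generator_in_adjoin: "ideal_in K \<Longrightarrow> f \<in> adjoin K f"
  using adjoinI[of 0 K 1 f] one_closed by (simp add: ideal_inD)

lemma adjoin_least:
  assumes "ideal_in L" "K \<subseteq> L" "f \<in> L"
  shows "adjoin K f \<subseteq> L"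
  using assms by (auto elim!: adjoinE intro!: ideal_inD(3,5)[OF assms(1)])

lemma adjoin_cong:
  assumes "ideal_in K" "f - g \<in> K" "f \<in> C" "g \<in> C"
  shows "adjoin K f = adjoin K g"
proof -
  have "adjoin K f \<subseteq> adjoin K g" if "f - g \<in> K" "g \<in> C" for f g
  proof (rule adjoin_least)
    show "ideal_in (adjoin K g)" using assms(1) that(2) by (rule ideal_in_adjoin)
    show "f \<in> adjoin K g" using adjoinI[OF that(1) one_closed, of g] by simp
  qed (rule subset_adjoin)
  moreover have "g - f \<in> K" using ideal_inD(6)[OF assms(1,2)] by simp
  ultimately show ?thesis using assms by blast
qed

lemma adjoin_commute: "adjoin (adjoin K f) g = adjoin (adjoin K g) f"
proof -
  have "adjoin (adjoin K f) g \<subseteq> adjoin (adjoin K g) f" for f g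
  proof
    fix z assume "z \<in> adjoin (adjoin K f) g"
    then obtain a c d where "a \<in> K" "c \<in> C" "d \<in> C" "z = a + f * c + g * d"
      by (auto elim!: adjoinE)
    moreover have "z = a + g * d + f * c" using calculation by simp
    ultimately show "z \<in> adjoin (adjoin K g) f" by (auto intro!: adjoinI)
  qed
  thus ?thesis by blast
qed

definition colon :: "'a set \<Rightarrow> 'a \<Rightarrow> 'a set" where
  "colon K f = {a \<in> C. f * a \<in> K}"

text \<open>Regularity without properness: each entry is a nonzerodivisor modulo the ideal generated by
  \<open>K\<close> and its predecessors. Properness is left out because it is not inherited by the ideals
  that occur in the inductions below.\<close>

primrec weakly_regular :: "'a set \<Rightarrow> 'a list \<Rightarrow> bool" where
  "weakly_regular K [] \<longleftrightarrow> True"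
| "weakly_regular K (f # fs) \<longleftrightarrow> colon K f \<subseteq> K \<and> weakly_regular (adjoin K f) fs"

primrec adjoin_list :: "'a set \<Rightarrow> 'a list \<Rightarrow> 'a set" where
  "adjoin_list K [] = K"
| "adjoin_list K (f # fs) = adjoin_list (adjoin K f) fs"

lemma adjoin_list_snoc: "adjoin_list K (fs @ [f]) = adjoin (adjoin_list K fs) f"
  by (induction fs arbitrary: K) auto

lemma ideal_in_adjoin_list: "ideal_in K \<Longrightarrow> set fs \<subseteq> C \<Longrightarrow> ideal_in (adjoin_list K fs)"
  by (induction fs arbitrary: K) (auto intro: ideal_in_adjoin)

lemma subset_adjoin_list: "K \<subseteq> adjoin_list K fs"
  by (induction fs arbitrary: K) (use subset_adjoin in fastforce)+

lemma set_subset_adjoin_list: "ideal_in K \<Longrightarrow> set fs \<subseteq> C \<Longrightarrow> set fs \<subseteq> adjoin_list K fs"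
proof (induction fs arbitrary: K)
  case (Cons f fs)
  have "f \<in> adjoin_list (adjoin K f) fs"
    using generator_in_adjoin[OF Cons.prems(1)] subset_adjoin_list by blast
  thus ?case using Cons.IH[of "adjoin K f"] Cons.prems ideal_in_adjoin by auto
qed auto

lemma adjoin_list_least:
  "ideal_in L \<Longrightarrow> K \<subseteq> L \<Longrightarrow> set fs \<subseteq> L \<Longrightarrow> adjoin_list K fs \<subseteq> L"
  by (induction fs arbitrary: K) (auto dest: adjoin_least)

lemma weakly_regular_iff:
  "weakly_regular K fs \<longleftrightarrow>
    (\<forall>i<length fs. colon (adjoin_list K (take i fs)) (fs ! i) \<subseteq> adjoin_list K (take i fs))"
  by (induction fs arbitrary: K) (simp_all add: All_less_Suc2)

text \<open>Multiplication by \<open>x\<close> gives the exact sequence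
  \<open>0 \<rightarrow> C/(K : x) \<rightarrow> C/K \<rightarrow> C/(K + xC) \<rightarrow> 0\<close>. A nonzerodivisor on the outer modules is one on the
  middle module, and the sequence stays exact when it is factored out.\<close>

lemma weakly_regular_extension:
  assumes "ideal_in K" "x \<in> C" "set fs \<subseteq> C"
    and "weakly_regular (adjoin K x) fs" "weakly_regular (colon K x) fs"
  shows "weakly_regular K fs"
  using assms
proof (induction fs arbitrary: K)
  case (Cons f fs)
  note K = ideal_inD[OF \<open>ideal_in K\<close>]
  have f: "f \<in> C" using Cons.prems by simp
  have nzd_quotient: "a \<in> adjoin K x" if "a \<in> C" "f * a \<in> adjoin K x" for a
    using Cons.prems that by (auto simp: colon_def)
  have nzd_colon: "x * a \<in> K" if "a \<in> C" "x * (f * a) \<in> K" for a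
    using Cons.prems that f by (auto simp: colon_def mult_closed)
  have "colon K f \<subseteq> K"
  proof
    fix a assume "a \<in> colon K f"
    hence a: "a \<in> C" "f * a \<in> K" by (auto simp: colon_def)
    then obtain b c where bc: "b \<in> K" "c \<in> C" "a = b + x * c"
      using nzd_quotient[of a] subset_adjoin[of K x] by (blast elim: adjoinE)
    have "x * (f * c) = f * a - f * b" using bc by (simp add: algebra_simps)
    also have "\<dots> \<in> K" using K(7)[OF a(2) K(4)[OF f bc(1)]] .
    finally have "x * c \<in> K" using nzd_colon bc by blast
    thus "a \<in> K" using bc K(3) by blast
  qed
  moreover have "weakly_regular (adjoin K f) fs"
  proof (rule Cons.IH)
    show "weakly_regular (adjoin (adjoin K f) x) fs"
      using Cons.prems by (simp add: adjoin_commute[of K f x])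
    \<comment> \<open>left exactness of the sequence modulo \<open>f\<close>\<close>
    have "colon (adjoin K f) x = adjoin (colon K x) f"
    proof (intro equalityI subsetI)
      fix z assume "z \<in> colon (adjoin K f) x"
      hence z: "z \<in> C" and "x * z \<in> adjoin K f" by (auto simp: colon_def)
      then obtain b c where bc: "b \<in> K" "c \<in> C" "x * z = b + f * c" by (blast elim: adjoinE)
      have "f * c = - b + x * z" using bc by simp
      also have "\<dots> \<in> adjoin K x" using bc z K(6) by (intro adjoinI) auto
      finally obtain b' e where be: "b' \<in> K" "e \<in> C" "c = b' + x * e"
        using nzd_quotient[of c] bc by (blast elim: adjoinE)
      have "x * (z - f * e) = b + f * b'" using bc be by (simp add: algebra_simps)
      also have "\<dots> \<in> K" using bc be f by (intro K(3) K(4))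
      finally have "z - f * e \<in> colon K x"
        using z f be closed by (simp add: colon_def)
      from adjoinI[OF this be(2), of f] show "z \<in> adjoin (colon K x) f" by simp
    next
      fix z assume "z \<in> adjoin (colon K x) f"
      then obtain d c where dc: "d \<in> C" "x * d \<in> K" "c \<in> C" "z = d + f * c"
        by (auto simp: colon_def elim!: adjoinE)
      have "x * z = x * d + f * (x * c)" using dc by (simp add: algebra_simps)
      moreover have "\<dots> \<in> adjoin K f" using dc Cons.prems by (intro adjoinI) (auto intro: closed)
      ultimately show "z \<in> colon (adjoin K f) x" using dc f closed by (simp add: colon_def)
    qed
    thus "weakly_regular (colon (adjoin K f) x) fs" using Cons.prems by simp
  qed (use Cons.prems ideal_in_adjoin in auto)
  ultimately show ?case by simp
qed simp

lemma colon_adjoin_Suc: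
  assumes "ideal_in K" "f \<in> C" "colon K f \<subseteq> K"
  shows "colon (adjoin K (f ^ Suc k)) f = adjoin K (f ^ k)"
proof (intro equalityI subsetI)
  fix z assume "z \<in> colon (adjoin K (f ^ Suc k)) f"
  then obtain b c where z: "z \<in> C" "b \<in> K" "c \<in> C" "f * z = b + f ^ Suc k * c"
    by (auto simp: colon_def elim!: adjoinE)
  have "f * (z - f ^ k * c) = b" using z by (simp add: algebra_simps)
  hence "z - f ^ k * c \<in> K" using z assms closed by (auto simp: colon_def)
  from adjoinI[OF this z(3), of "f ^ k"] show "z \<in> adjoin K (f ^ k)" by simp
next
  note K = ideal_inD[OF \<open>ideal_in K\<close>]
  fix z assume "z \<in> adjoin K (f ^ k)"
  then obtain b c where z: "b \<in> K" "c \<in> C" "z = b + f ^ k * c" by (auto elim!: adjoinE)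
  hence "f * z = f * b + f ^ Suc k * c" by (simp add: algebra_simps)
  moreover have "\<dots> \<in> adjoin K (f ^ Suc k)" using z assms(2) by (intro adjoinI K(4))
  ultimately show "z \<in> colon (adjoin K (f ^ Suc k)) f"
    using z assms(2) K(1) closed by (simp add: colon_def)
qed

text \<open>\<open>C/(K + f\<^bsup>k+1\<^esup>C)\<close> is an extension of \<open>C/(K + fC)\<close> by \<open>C/(K + f\<^sup>kC)\<close>. The induction can start at
  the zero module, where \<open>k = 0\<close>.\<close>

lemma weakly_regular_power_Cons:
  assumes "ideal_in K" "f \<in> C" "set fs \<subseteq> C" "weakly_regular K (f # fs)"
  shows "weakly_regular (adjoin K (f ^ k)) fs"
proof (induction k)
  case 0
  have improper: "weakly_regular L fs" if "C \<subseteq> L" for L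
    using that
  proof (induction fs arbitrary: L)
    case (Cons g gs)
    thus ?case using subset_adjoin[of L g] by (auto simp: colon_def)
  qed simp
  have "c \<in> adjoin K 1" if "c \<in> C" for c
    using adjoinI[of 0 K c 1] that assms(1) by (simp add: ideal_inD)
  thus ?case by (auto intro: improper)
next
  case (Suc k)
  have ideal: "ideal_in (adjoin K (f ^ Suc k))"
    using assms ideal_in_adjoin power_closed by blast
  have "adjoin (adjoin K (f ^ Suc k)) f = adjoin K f"
  proof (rule equalityI)
    have "f * f ^ k \<in> adjoin K f"
      using ideal_inD(5)[OF ideal_in_adjoin[OF assms(1,2)] power_closed[OF assms(2)]]
        generator_in_adjoin[OF assms(1)] by blast
    thus "adjoin (adjoin K (f ^ Suc k)) f \<subseteq> adjoin K f"
      using assms ideal_in_adjoin subset_adjoin generator_in_adjoin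
      by (intro adjoin_least) auto
    show "adjoin K f \<subseteq> adjoin (adjoin K (f ^ Suc k)) f"
      using assms(2) subset_adjoin ideal_in_adjoin[OF ideal] generator_in_adjoin[OF ideal]
      by (intro adjoin_least) blast+
  qed
  moreover have "colon (adjoin K (f ^ Suc k)) f = adjoin K (f ^ k)"
    using assms by (intro colon_adjoin_Suc) auto
  ultimately show ?case
    using weakly_regular_extension[OF ideal assms(2,3)] assms(4) Suc by simp
qed

lemma weakly_regular_powers:
  assumes "ideal_in K" "set fs \<subseteq> C" "weakly_regular K fs"
  shows "weakly_regular K (map (\<lambda>f. f ^ k) fs)"
  using assms
proof (induction fs arbitrary: K)
  case (Cons f fs)
  have "a \<in> K" if "a \<in> C" "f ^ j * a \<in> K" for a j
    using that
  proof (induction j)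
    case (Suc j)
    have "f ^ j * a \<in> colon K f"
      using Suc.prems Cons.prems(2) closed by (simp add: colon_def mult.assoc)
    thus ?case using Cons.prems Suc by auto
  qed simp
  moreover have "weakly_regular (adjoin K (f ^ k)) fs"
    using Cons.prems by (intro weakly_regular_power_Cons) auto
  hence "weakly_regular (adjoin K (f ^ k)) (map (\<lambda>f. f ^ k) fs)"
    using Cons.prems ideal_in_adjoin power_closed by (intro Cons.IH) auto
  ultimately show ?case by (auto simp: colon_def)
qed simp

lemma list_power_closed: "set fs \<subseteq> C \<Longrightarrow> list_power fs as \<in> C"
proof (induction fs arbitrary: as)
  case (Cons f fs)
  thus ?case by (cases as) (auto simp: list_power_def intro: closed)
qed (simp add: list_power_def one_closed)

text \<open>The engine behind both upper bounds. In a relation among the \<open>fs\<close>, divide by the largest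
  power of the first entry \<open>f\<close> that occurs in all terms, which is possible modulo \<open>P 0\<close>. Then
  \<open>f\<close> vanishes modulo \<open>P 1\<close>, and what remains is a nontrivial relation among the other entries.
  At the end a unit times \<open>m\<close> is left.\<close>

lemma relation_descends:
  assumes "\<And>i. i \<le> length fs \<Longrightarrow> ideal_in (P i)"
    and "\<And>i. i < length fs \<Longrightarrow> P i \<subseteq> P (Suc i) \<and> fs ! i \<in> P (Suc i) \<and> colon (P i) (fs ! i) \<subseteq> P i"
    and "m \<in> C" "finite A" "A \<noteq> {}" "\<And>as. as \<in> A \<Longrightarrow> length as = length fs"
    and "\<And>as. as \<in> A \<Longrightarrow> c as \<in> C \<and> (\<exists>d\<in>C. d * c as = 1)"
    and "(\<Sum>as\<in>A. c as * list_power fs as) * m \<in> P 0"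
  shows "m \<in> P (length fs)"
  using assms
proof (induction fs arbitrary: P A c)
  case Nil
  then obtain as where "as \<in> A" by blast
  moreover have "as = []" if "as \<in> A" for as using Nil.prems(6)[OF that] by simp
  ultimately have A: "A = {[]}" by blast
  then obtain d where "d \<in> C" "d * c [] = 1" using Nil.prems(7)[of "[]"] by blast
  moreover have "d * (c [] * m) \<in> P 0"
    using Nil.prems(8) calculation ideal_inD(4)[OF Nil.prems(1)[of 0]]
    by (simp add: A list_power_Nil)
  ultimately show ?case by (simp flip: mult.assoc)
next
  case (Cons f fs)
  have P: "ideal_in (P i)" if "i \<le> Suc (length fs)" for i using Cons.prems(1)[of i] that by simp
  have fC: "f \<in> C" using Cons.prems(2)[of 0] P[of 1] ideal_inD(1) by fastforce
  have "fs ! i \<in> C" if "i < length fs" for i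
    using Cons.prems(2)[of "Suc i"] P[of "Suc (Suc i)"] ideal_inD(1) that by fastforce
  hence fsC: "set fs \<subseteq> C" by (auto simp: in_set_conv_nth)
  have split: "as = hd as # tl as" if "as \<in> A" for as
    using Cons.prems(6)[OF that] by (cases as) auto
  define b where "b = Min (hd ` A)"
  have b: "b \<le> hd as" if "as \<in> A" for as
    unfolding b_def using that Cons.prems by simp
  define A1 where "A1 = {as \<in> A. hd as = b}"
  have "b \<in> hd ` A" unfolding b_def using Cons.prems by (intro Min_in) auto
  hence A1: "A1 \<noteq> {}" "finite A1" "A1 \<subseteq> A" using Cons.prems by (auto simp: A1_def)
  define g where "g = (\<Sum>as\<in>A - A1. c as * (f ^ (hd as - Suc b) * list_power fs (tl as)))"
  have gC: "g \<in> C" unfolding g_def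
    using Cons.prems(7) fC fsC list_power_closed by (intro closed) auto
  define h where "h = (\<Sum>as\<in>A1. c as * list_power fs (tl as))"
  have hC: "h \<in> C" unfolding h_def
    using Cons.prems(7) A1(3) fsC list_power_closed by (intro closed) auto
  have "(\<Sum>as\<in>A. c as * list_power (f # fs) as)
      = (\<Sum>as\<in>A1. c as * list_power (f # fs) as) + (\<Sum>as\<in>A - A1. c as * list_power (f # fs) as)"
    using A1 Cons.prems(4) by (metis add.commute sum.subset_diff)
  also have "(\<Sum>as\<in>A1. c as * list_power (f # fs) as) = f ^ b * h"
    unfolding h_def sum_distrib_left
  proof (rule sum.cong)
    fix as assume "as \<in> A1"
    hence "as = b # tl as" using split A1 by (auto simp: A1_def)
    hence "list_power (f # fs) as = f ^ b * list_power fs (tl as)" by (metis list_power_Cons)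
    thus "c as * list_power (f # fs) as = f ^ b * (c as * list_power fs (tl as))" by simp
  qed simp
  also have "(\<Sum>as\<in>A - A1. c as * list_power (f # fs) as) = f ^ b * (f * g)"
    unfolding g_def sum_distrib_left
  proof (rule sum.cong)
    fix as assume as: "as \<in> A - A1"
    hence "b < hd as" using b by (fastforce simp: A1_def)
    hence "f ^ hd as = f ^ b * (f * f ^ (hd as - Suc b))"
      by (metis Suc_leI add_Suc_shift le_add_diff_inverse power_Suc power_add)
    moreover have "list_power (f # fs) as = f ^ hd as * list_power fs (tl as)"
      using split as by (metis DiffD1 list_power_Cons)
    ultimately show "c as * list_power (f # fs) as
      = f ^ b * (f * (c as * (f ^ (hd as - Suc b) * list_power fs (tl as))))"
      by (simp add: algebra_simps)
  qed simp
  finally have "f ^ b * ((h + f * g) * m) \<in> P 0"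
    using Cons.prems(8) by (simp add: algebra_simps)
  moreover have "a \<in> P 0" if "a \<in> C" "f ^ j * a \<in> P 0" for a j
    using that
  proof (induction j)
    case (Suc j)
    have "f ^ j * a \<in> colon (P 0) f"
      using Suc.prems fC closed by (simp add: colon_def mult.assoc)
    thus ?case using Cons.prems(2)[of 0] Suc by auto
  qed simp
  ultimately have "(h + f * g) * m \<in> P 0"
    using fC gC hC Cons.prems(3) closed by metis
  hence "(h + f * g) * m \<in> P 1" using Cons.prems(2)[of 0] by auto
  moreover have "f * (g * m) \<in> P 1"
    using Cons.prems(2)[of 0] Cons.prems(3) gC P[of 1] by (auto intro!: ideal_inD(5) closed)
  ultimately have "(h + f * g) * m - f * (g * m) \<in> P 1"
    using P[of 1] ideal_inD(7) by auto
  hence hm: "h * m \<in> P 1" by (simp add: algebra_simps)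
  have inj: "inj_on tl A1"
    using split A1 by (intro inj_onI) (metis (mono_tags, lifting) A1_def mem_Collect_eq)
  have "m \<in> (P \<circ> Suc) (length fs)"
  proof (rule Cons.IH[of _ "tl ` A1" "\<lambda>as. c (b # as)"])
    have "h = (\<Sum>as\<in>tl ` A1. c (b # as) * list_power fs as)"
      unfolding h_def sum.reindex[OF inj] o_def using split A1
      by (intro sum.cong) (auto simp: A1_def)
    thus "(\<Sum>as\<in>tl ` A1. c (b # as) * list_power fs as) * m \<in> (P \<circ> Suc) 0"
      using hm by simp
    show "c (b # as) \<in> C \<and> (\<exists>d\<in>C. d * c (b # as) = 1)" if "as \<in> tl ` A1" for as
    proof -
      from that obtain as' where "as' \<in> A" "hd as' = b" "as = tl as'" by (auto simp: A1_def)
      hence "b # as = as'" using split by metis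
      thus ?thesis using Cons.prems(7) \<open>as' \<in> A\<close> by simp
    qed
    show "(P \<circ> Suc) i \<subseteq> (P \<circ> Suc) (Suc i) \<and> fs ! i \<in> (P \<circ> Suc) (Suc i)
      \<and> colon ((P \<circ> Suc) i) (fs ! i) \<subseteq> (P \<circ> Suc) i" if "i < length fs" for i
      using Cons.prems(2)[of "Suc i"] that by simp
    show "ideal_in ((P \<circ> Suc) i)" if "i \<le> length fs" for i using P that by simp
    show "length as = length fs" if "as \<in> tl ` A1" for as
    proof -
      from that A1(3) obtain as' where "as' \<in> A" "as = tl as'" by blast
      thus ?thesis using Cons.prems(6)[of as'] by simp
    qed
  qed (use A1 Cons.prems(3) in auto)
  thus ?case by simp
qed

lemma weakly_regular_relation:
  assumes "ideal_in K" "set fs \<subseteq> C" "weakly_regular K fs"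
    and "m \<in> C" "finite A" "A \<noteq> {}" "\<And>as. as \<in> A \<Longrightarrow> length as = length fs"
    and "\<And>as. as \<in> A \<Longrightarrow> c as \<in> C \<and> (\<exists>d\<in>C. d * c as = 1)"
    and "(\<Sum>as\<in>A. c as * list_power fs as) * m \<in> K"
  shows "m \<in> adjoin_list K fs"
proof -
  let ?P = "\<lambda>i. adjoin_list K (take i fs)"
  have ideal: "ideal_in (?P i)" for i
    using assms(1,2) set_take_subset by (intro ideal_in_adjoin_list) fastforce+
  have step: "?P (Suc i) = adjoin (?P i) (fs ! i)" if "i < length fs" for i
    using that by (simp add: take_Suc_conv_app_nth adjoin_list_snoc)
  have "m \<in> ?P (length fs)"
  proof (rule relation_descends[where P = ?P and fs = fs])
    fix i assume i: "i < length fs"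
    show "?P i \<subseteq> ?P (Suc i) \<and> fs ! i \<in> ?P (Suc i) \<and> colon (?P i) (fs ! i) \<subseteq> ?P i"
      unfolding step[OF i] using subset_adjoin generator_in_adjoin[OF ideal] assms(3) i
      by (auto simp: weakly_regular_iff)
  qed (use assms ideal in auto)
  thus ?thesis by simp
qed

end

section \<open>Monomials and monomial ideals\<close>

abbreviation "lookup \<equiv> Poly_Mapping.lookup"
abbreviation "keys \<equiv> Poly_Mapping.keys"
abbreviation "single \<equiv> Poly_Mapping.single"

abbreviation polys :: "nat \<Rightarrow> 'k::field mpoly set" where
  "polys n \<equiv> carrier (polynomial_ring n)"

lemma mem_polys_iff: "p \<in> polys n \<longleftrightarrow> (\<forall>w\<in>keys p. keys w \<subseteq> {1..n})"
  by (simp add: polynomial_ring_def)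

lemma polynomial_ring_ops:
  "x \<otimes>\<^bsub>polynomial_ring n\<^esub> y = x * y" "x \<oplus>\<^bsub>polynomial_ring n\<^esub> y = x + y"
  "\<one>\<^bsub>polynomial_ring n\<^esub> = 1" "\<zero>\<^bsub>polynomial_ring n\<^esub> = 0"
  by (simp_all add: polynomial_ring_def)

interpretation polys: subring_carrier "polys n :: 'k::field mpoly set" for n
proof -
  interpret R: cring "polynomial_ring n :: 'k mpoly ring" by (rule cring_polynomial_ring)
  show "subring_carrier (polys n :: 'k mpoly set)"
  proof
    show "- a \<in> polys n" if "a \<in> polys n" for a :: "'k mpoly"
      using that by (simp add: mem_polys_iff in_keys_iff)
  qed (fact R.zero_closed[unfolded polynomial_ring_ops] R.one_closed[unfolded polynomial_ring_ops]
      R.add.m_closed[unfolded polynomial_ring_ops] R.m_closed[unfolded polynomial_ring_ops])+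
qed

lemma keys_add_monom: "keys (v + w :: monom) = keys v \<union> keys w"
  by (auto simp: in_keys_iff lookup_add)

lemma keys_var_monom: "keys (var_monom i) = {i}"
  by (simp add: var_monom_def)

lemma lookup_set_monom: "finite G \<Longrightarrow> lookup (set_monom G) i = (if i \<in> G then 1 else 0)"
  by (simp add: set_monom_def var_monom_def lookup_sum lookup_single when_def)

lemma keys_set_monom: "finite G \<Longrightarrow> keys (set_monom G) = G"
  by (simp add: set_eq_iff in_keys_iff lookup_set_monom)

lemma finite_vertices: "A \<subseteq> {1..n} \<Longrightarrow> finite (A :: nat set)"
  using finite_subset by blast

lemma set_monom_divides:
  assumes "finite R" "R \<subseteq> keys w"
  shows "w = set_monom R + (w - set_monom R)"
proof (rule poly_mapping_eqI)
  fix i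
  have "i \<in> R \<Longrightarrow> lookup w i > 0" using assms by (auto simp: in_keys_iff)
  thus "lookup w i = lookup (set_monom R + (w - set_monom R)) i"
    using assms by (simp add: lookup_add lookup_minus lookup_set_monom)
qed

lemma lookup_monom_poly_mult: "lookup (monom_poly v * p) (v + w) = lookup p w"
  by (simp add: monom_poly_def lookup_mult lookup_single when_mult)

lemma keys_monom_poly: "keys (monom_poly w :: 'k::field mpoly) = {w}"
  by (simp add: monom_poly_def)

lemma keys_monom_poly_mult: "keys (monom_poly v * p :: 'k::field mpoly) = (+) v ` keys p"
proof
  show "keys (monom_poly v * p) \<subseteq> (+) v ` keys p"
    using keys_mult[of "monom_poly v" p] by (auto simp: keys_monom_poly)
  show "(+) v ` keys p \<subseteq> keys (monom_poly v * p)"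
    by (auto simp: in_keys_iff lookup_monom_poly_mult)
qed

lemma monom_poly_add: "monom_poly (v + w) = (monom_poly v * monom_poly w :: 'k::field mpoly)"
  by (simp add: monom_poly_def mult_single)

lemma monom_poly_closed: "keys w \<subseteq> {1..n} \<Longrightarrow> monom_poly w \<in> polys n"
  by (simp add: mem_polys_iff keys_monom_poly)

lemma set_monom_closed: "G \<subseteq> {1..n} \<Longrightarrow> monom_poly (set_monom G) \<in> polys n"
  by (simp add: monom_poly_closed keys_set_monom finite_vertices)

lemma monom_poly_dividesE:
  fixes p :: "'k::field mpoly"
  assumes "\<And>w. w \<in> keys p \<Longrightarrow> \<exists>w'. w = v + w'"
  obtains p' where "p = monom_poly v * p'"
proof
  let ?q = "Poly_Mapping.map_key ((+) v) p"
  have q: "lookup ?q w = lookup p (v + w)" for w by (subst map_key.rep_eq) (auto simp: inj_def)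
  show "p = monom_poly v * ?q"
  proof (rule poly_mapping_eqI)
    fix w
    show "lookup p w = lookup (monom_poly v * ?q) w"
    proof (cases "\<exists>w'. w = v + w'")
      case True
      thus ?thesis by (auto simp: lookup_monom_poly_mult q)
    next
      case False
      hence "w \<notin> keys p" "w \<notin> keys (monom_poly v * ?q)"
        using assms by (auto simp: keys_monom_poly_mult)
      thus ?thesis by (simp add: in_keys_iff)
    qed
  qed
qed

definition restrict_terms :: "monom set \<Rightarrow> 'k::field mpoly \<Rightarrow> 'k mpoly" where
  "restrict_terms W p = Poly_Mapping.mapp (\<lambda>w c. if w \<in> W then c else 0) p"

lemma lookup_restrict_terms: "lookup (restrict_terms W p) w = (if w \<in> W then lookup p w else 0)"
  by (simp add: restrict_terms_def lookup_mapp when_def in_keys_iff)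

lemma keys_restrict_terms: "keys (restrict_terms W p) = keys p \<inter> W"
  by (auto simp: in_keys_iff lookup_restrict_terms split: if_splits)

lemma restrict_terms_add: "restrict_terms W (p + q) = restrict_terms W p + restrict_terms W q"
  by (rule poly_mapping_eqI) (simp add: lookup_restrict_terms lookup_add)

lemma restrict_terms_zero: "restrict_terms W 0 = 0"
  by (rule poly_mapping_eqI) (simp add: lookup_restrict_terms)

lemma restrict_terms_sum: "restrict_terms W (sum f Y) = (\<Sum>x\<in>Y. restrict_terms W (f x))"
  by (induction Y rule: infinite_finite_induct)
    (simp_all add: restrict_terms_zero restrict_terms_add)

lemma restrict_terms_split: "restrict_terms W p + restrict_terms (- W) p = p"
  by (rule poly_mapping_eqI) (simp add: lookup_restrict_terms lookup_add)

lemma restrict_terms_id: "keys p \<subseteq> W \<Longrightarrow> restrict_terms W p = p"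
  by (rule poly_mapping_eqI) (auto simp: lookup_restrict_terms in_keys_iff)

lemma restrict_terms_eq_0_iff: "restrict_terms W p = 0 \<longleftrightarrow> keys p \<inter> W = {}"
  by (metis keys_eq_empty keys_restrict_terms)

lemma restrict_terms_closed: "p \<in> polys n \<Longrightarrow> restrict_terms W p \<in> polys n"
  by (auto simp: mem_polys_iff keys_restrict_terms)

lemma factor_closed:
  "monom_poly v * p \<in> polys n \<Longrightarrow> p \<in> polys n"
  by (auto simp: mem_polys_iff keys_monom_poly_mult keys_add_monom)

text \<open>The Stanley--Reisner ideal of a simplicial complex, as the span of the monomials whose
  support is not a face.\<close>

definition face_ideal :: "nat \<Rightarrow> nat set set \<Rightarrow> 'k::field mpoly set" where
  "face_ideal n \<Gamma> = {p \<in> polys n. \<forall>w\<in>keys p. keys w \<notin> \<Gamma>}"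

lemma monom_poly_mem_face_ideal:
  "keys w \<subseteq> {1..n} \<Longrightarrow> keys w \<notin> \<Gamma> \<Longrightarrow> monom_poly w \<in> face_ideal n \<Gamma>"
  by (simp add: face_ideal_def keys_monom_poly monom_poly_closed)

definition down_closed :: "'a set set \<Rightarrow> bool" where
  "down_closed \<Gamma> \<longleftrightarrow> (\<forall>A\<in>\<Gamma>. \<forall>B\<subseteq>A. B \<in> \<Gamma>)"

lemma down_closed_Pow: "down_closed (Pow G)"
  by (auto simp: down_closed_def)

lemma ideal_in_terms:
  assumes "\<And>v w. w \<in> W \<Longrightarrow> v + w \<in> W"
  shows "polys.ideal_in n {p \<in> polys n. keys p \<subseteq> W}"
  unfolding polys.ideal_in_def
proof (intro conjI ballI)
  fix a b :: "'k::field mpoly" assume "a \<in> {p \<in> polys n. keys p \<subseteq> W}" "b \<in> {p \<in> polys n. keys p \<subseteq> W}"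
  hence "a + b \<in> polys n" "keys (a + b) \<subseteq> W"
    using Poly_Mapping.keys_add[of a b] polys.add_closed by blast+
  thus "a + b \<in> {p \<in> polys n. keys p \<subseteq> W}" by blast
next
  fix a b :: "'k::field mpoly" assume ab: "a \<in> polys n" "b \<in> {p \<in> polys n. keys p \<subseteq> W}"
  have "w \<in> W" if w: "w \<in> keys (a * b)" for w
  proof -
    from keys_mult[of a b] w obtain v v' where "w = v + v'" "v' \<in> keys b" by blast
    thus ?thesis using assms ab by blast
  qed
  thus "a * b \<in> {p \<in> polys n. keys p \<subseteq> W}" using polys.mult_closed ab by blast
qed (auto intro: polys.zero_closed)

lemma ideal_in_face_ideal:
  assumes "down_closed \<Gamma>"
  shows "polys.ideal_in n (face_ideal n \<Gamma> :: 'k::field mpoly set)"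
proof -
  have "face_ideal n \<Gamma> = {p :: 'k mpoly. p \<in> polys n \<and> keys p \<subseteq> {w. keys w \<notin> \<Gamma>}}"
    by (auto simp: face_ideal_def)
  moreover have "polys.ideal_in n {p :: 'k mpoly. p \<in> polys n \<and> keys p \<subseteq> {w. keys w \<notin> \<Gamma>}}"
    using assms by (intro ideal_in_terms) (auto simp: keys_add_monom down_closed_def)
  ultimately show ?thesis by simp
qed

lemma colon_face_ideal:
  assumes "R \<subseteq> {1..n}"
  shows "polys.colon n (face_ideal n \<Gamma> :: 'k::field mpoly set) (monom_poly (set_monom R))
    = face_ideal n {G. G \<union> R \<in> \<Gamma>}"
proof -
  have R: "finite R" using assms finite_subset by blast
  let ?x = "monom_poly (set_monom R) :: 'k mpoly"
  have "?x \<in> polys n"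
    using assms by (simp add: monom_poly_closed keys_set_monom R)
  hence "?x * p \<in> polys n" if "p \<in> polys n" for p using polys.mult_closed that by blast
  moreover have "(\<forall>w\<in>keys (?x * p). keys w \<notin> \<Gamma>) \<longleftrightarrow> (\<forall>w\<in>keys p. keys w \<union> R \<notin> \<Gamma>)" for p
    by (simp add: keys_monom_poly_mult keys_add_monom keys_set_monom R Un_commute)
  ultimately show ?thesis
    by (simp add: polys.colon_def face_ideal_def cong: conj_cong)
qed

lemma adjoin_face_ideal:
  assumes "down_closed \<Gamma>" "R \<subseteq> {1..n}"
  shows "polys.adjoin n (face_ideal n \<Gamma> :: 'k::field mpoly set) (monom_poly (set_monom R))
    = face_ideal n {G \<in> \<Gamma>. \<not> R \<subseteq> G}" (is "?L = ?R")
proof (rule equalityI)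
  have R: "finite R" using assms finite_subset by blast
  have "down_closed {G \<in> \<Gamma>. \<not> R \<subseteq> G}" using assms(1) by (auto simp: down_closed_def)
  moreover have "face_ideal n \<Gamma> \<subseteq> ?R" by (auto simp: face_ideal_def)
  moreover have "monom_poly (set_monom R) \<in> ?R"
    using assms(2) by (simp add: face_ideal_def keys_monom_poly keys_set_monom R monom_poly_closed)
  ultimately show "?L \<subseteq> ?R" by (intro polys.adjoin_least ideal_in_face_ideal)
  show "?R \<subseteq> ?L"
  proof
    fix p :: "'k mpoly" assume p: "p \<in> ?R"
    let ?W = "{w. keys w \<notin> \<Gamma>}"
    have "R \<subseteq> keys w" if "w \<in> keys (restrict_terms (- ?W) p)" for w
      using p that by (auto simp: face_ideal_def keys_restrict_terms)
    hence divides: "\<exists>w'. w = set_monom R + w'" if "w \<in> keys (restrict_terms (- ?W) p)" for w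
      using set_monom_divides[OF R] that by (intro exI) blast
    obtain p' where p': "restrict_terms (- ?W) p = monom_poly (set_monom R) * p'"
      by (rule monom_poly_dividesE[OF divides])
    have "p \<in> polys n" using p by (simp add: face_ideal_def)
    from restrict_terms_closed[OF this, of "- ?W"] have "p' \<in> polys n"
      unfolding p' by (rule factor_closed)
    moreover have "restrict_terms ?W p \<in> face_ideal n \<Gamma>"
      using \<open>p \<in> polys n\<close> by (simp add: face_ideal_def keys_restrict_terms restrict_terms_closed)
    ultimately have "restrict_terms ?W p + monom_poly (set_monom R) * p' \<in> ?L"
      by (intro polys.adjoinI)
    thus "p \<in> ?L" by (simp add: restrict_terms_split flip: p')
  qed
qed

text \<open>For a squarefree monomial \<open>x\<^sub>R\<close> both outer terms of the exact sequence are face rings again: of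
  the sets that remain faces after adding \<open>R\<close>, and of the faces that do not contain \<open>R\<close>. This turns
  regularity into a matter of decomposing complexes.\<close>

lemma weakly_regular_face_ideal:
  assumes "down_closed \<Gamma>" "R \<subseteq> {1..n}" "set fs \<subseteq> polys n"
    and "polys.weakly_regular n (face_ideal n {G. G \<union> R \<in> \<Gamma>}) fs"
    and "polys.weakly_regular n (face_ideal n {G \<in> \<Gamma>. \<not> R \<subseteq> G}) fs"
  shows "polys.weakly_regular n (face_ideal n \<Gamma> :: 'k::field mpoly set) fs"
proof (rule polys.weakly_regular_extension)
  have "finite R" using assms finite_subset by blast
  thus "monom_poly (set_monom R) \<in> (polys n :: 'k mpoly set)"
    using assms by (simp add: monom_poly_closed keys_set_monom)
qed (use assms in \<open>simp_all add: ideal_in_face_ideal colon_face_ideal adjoin_face_ideal\<close>)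

text \<open>Setting the variables outside \<open>G\<close> to zero is a ring homomorphism. Its kernel is the face ideal of
  the simplex \<open>G\<close>, which is therefore prime.\<close>

lemma restrict_terms_face_mult:
  "restrict_terms {w. keys w \<subseteq> G} (p * q)
    = restrict_terms {w. keys w \<subseteq> G} p * restrict_terms {w. keys w \<subseteq> G} (q :: 'k::field mpoly)"
proof -
  let ?W = "{w. keys w \<subseteq> G}"
  define p1 p2 q1 q2 where defs: "p1 = restrict_terms ?W p" "p2 = restrict_terms (- ?W) p"
    "q1 = restrict_terms ?W q" "q2 = restrict_terms (- ?W) q"
  have "p * q = (p1 + p2) * (q1 + q2)" by (simp add: defs restrict_terms_split)
  also have "\<dots> = p1 * q1 + (p1 * q2 + p2 * (q1 + q2))" by (simp add: algebra_simps)
  finally have "p * q = p1 * q1 + (p1 * q2 + p2 * (q1 + q2))" .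
  moreover have "keys (p1 * q1) \<subseteq> ?W"
    using keys_mult[of p1 q1] by (fastforce simp: defs keys_restrict_terms keys_add_monom)
  moreover have "keys (p1 * q2) \<inter> ?W = {}" "keys (p2 * (q1 + q2)) \<inter> ?W = {}"
    using keys_mult[of p1 q2] keys_mult[of p2 "q1 + q2"]
    by (fastforce simp: defs keys_restrict_terms keys_add_monom)+
  ultimately show ?thesis
    by (simp add: restrict_terms_add restrict_terms_id flip: restrict_terms_eq_0_iff defs)
qed

lemma face_ideal_Pow: "face_ideal n (Pow G) = {p \<in> polys n. restrict_terms {w. keys w \<subseteq> G} p = 0}"
  by (auto simp: face_ideal_def restrict_terms_eq_0_iff)

lemma face_ideal_Pow_prime:
  assumes "p * q \<in> face_ideal n (Pow G)" "p \<in> polys n" "q \<in> polys n"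
  shows "p \<in> face_ideal n (Pow G) \<or> q \<in> face_ideal n (Pow G :: nat set set)"
  using assms by (auto simp: face_ideal_Pow restrict_terms_face_mult)

lemma face_ideal_Pow_strict:
  assumes "j \<in> G" "j \<in> {1..n}"
  shows "face_ideal n (Pow G) \<subset> (face_ideal n (Pow (G - {j})) :: 'k::field mpoly set)"
proof -
  let ?x = "monom_poly (var_monom j) :: 'k mpoly"
  have "?x \<in> polys n" using assms(2) by (intro monom_poly_closed) (simp add: keys_var_monom)
  hence "?x \<notin> face_ideal n (Pow G)" "?x \<in> face_ideal n (Pow (G - {j}))"
    using assms(1) by (simp_all add: face_ideal_def keys_monom_poly keys_var_monom)
  moreover have "face_ideal n (Pow G) \<subseteq> (face_ideal n (Pow (G - {j})) :: 'k mpoly set)"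
    by (auto simp: face_ideal_def)
  ultimately show ?thesis by blast
qed

section \<open>Homogeneous elements\<close>

definition mdeg :: "monom \<Rightarrow> nat" where
  "mdeg w = (\<Sum>i\<in>keys w. lookup w i)"

lemma mdeg_superset: "finite A \<Longrightarrow> keys w \<subseteq> A \<Longrightarrow> mdeg w = (\<Sum>i\<in>A. lookup w i)"
  unfolding mdeg_def by (rule sum.mono_neutral_left) (auto simp: in_keys_iff)

lemma mdeg_add: "mdeg (v + w) = mdeg v + mdeg w"
proof -
  have "mdeg u = (\<Sum>i\<in>keys v \<union> keys w. lookup u i)" if "keys u \<subseteq> keys v \<union> keys w" for u
    using that by (intro mdeg_superset) auto
  thus ?thesis by (simp add: keys_add_monom lookup_add sum.distrib)
qed

lemma mdeg_set_monom: "finite G \<Longrightarrow> mdeg (set_monom G) = card G"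
  by (simp add: mdeg_superset[of G] keys_set_monom lookup_set_monom)

lemma mdeg_var_monom: "mdeg (var_monom i) = 1"
  by (simp add: var_monom_def mdeg_def)

lemma lookup_le_mdeg: "lookup w i \<le> mdeg w"
proof (cases "i \<in> keys w")
  case True
  thus ?thesis unfolding mdeg_def by (intro member_le_sum) auto
qed (simp add: in_keys_iff)

lemma mdeg_eq_0_iff: "mdeg w = 0 \<longleftrightarrow> w = 0"
proof
  assume "mdeg w = 0"
  hence "lookup w i = 0" for i using lookup_le_mdeg[of w i] by simp
  thus "w = 0" by (intro poly_mapping_eqI) simp
qed (simp add: mdeg_def)

definition homogeneous :: "nat \<Rightarrow> 'k::field mpoly \<Rightarrow> bool" where
  "homogeneous d p \<longleftrightarrow> keys p \<subseteq> {w. mdeg w = d}"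

abbreviation component :: "nat \<Rightarrow> 'k::field mpoly \<Rightarrow> 'k mpoly" where
  "component d \<equiv> restrict_terms {w. mdeg w = d}"

definition graded :: "'k::field mpoly set \<Rightarrow> bool" where
  "graded K \<longleftrightarrow> (\<forall>p\<in>K. \<forall>d. component d p \<in> K)"

lemma component_mult:
  assumes "homogeneous e f"
  shows "component (e + d) (f * p) = f * component d p"
proof -
  let ?p = "restrict_terms (- {w. mdeg w = d}) p"
  have "f * p = f * component d p + f * ?p"
    by (simp add: restrict_terms_split flip: distrib_left)
  moreover have "keys (f * component d p) \<subseteq> {w. mdeg w = e + d}"
    using keys_mult[of f "component d p"] assms
    by (fastforce simp: homogeneous_def keys_restrict_terms mdeg_add)
  moreover have "keys (f * ?p) \<inter> {w. mdeg w = e + d} = {}"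
    using keys_mult[of f ?p] assms
    by (fastforce simp: homogeneous_def keys_restrict_terms mdeg_add)
  ultimately show ?thesis
    by (simp add: restrict_terms_add restrict_terms_id flip: restrict_terms_eq_0_iff)
qed

lemma component_mult_low:
  assumes "homogeneous e f" "d < e"
  shows "component d (f * p) = 0"
  using keys_mult[of f p] assms
  by (fastforce simp: restrict_terms_eq_0_iff homogeneous_def mdeg_add)

lemma homogeneous_mult: "homogeneous d p \<Longrightarrow> homogeneous e q \<Longrightarrow> homogeneous (d + e) (p * q)"
  using keys_mult[of p q] by (fastforce simp: homogeneous_def mdeg_add)

lemma homogeneous_power: "homogeneous d p \<Longrightarrow> homogeneous (k * d) (p ^ k)"
proof (induction k)
  case 0
  show ?case by (simp add: homogeneous_def mdeg_def)
next
  case (Suc k)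
  thus ?case using homogeneous_mult[of d p "k * d"] by simp
qed

lemma graded_memI:
  assumes "polys.ideal_in n K" "\<And>d. component d p \<in> K"
  shows "p \<in> K"
proof -
  have "p = (\<Sum>d\<in>mdeg ` keys p. component d p)"
    by (rule poly_mapping_eqI)
      (auto simp: lookup_sum lookup_restrict_terms in_keys_iff)
  also have "sum (\<lambda>d. component d p) A \<in> K" for A
    using assms by (induction A rule: infinite_finite_induct) (auto intro: polys.ideal_inD)
  finally show ?thesis .
qed

lemma graded_face_ideal: "graded (face_ideal n \<Gamma>)"
  by (auto simp: graded_def face_ideal_def keys_restrict_terms restrict_terms_closed)

lemma graded_adjoin:
  assumes "polys.ideal_in n K" "graded K" "homogeneous e f"
  shows "graded (polys.adjoin n K f)"
  unfolding graded_def
proof (intro ballI allI)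
  fix p d assume "p \<in> polys.adjoin n K f"
  then obtain a c where ac: "a \<in> K" "c \<in> polys n" "p = a + f * c" by (rule polys.adjoinE)
  have a: "component d a \<in> K" using assms ac by (simp add: graded_def)
  show "component d p \<in> polys.adjoin n K f"
  proof (cases "d < e")
    case True
    thus ?thesis using ac a component_mult_low[OF assms(3)] polys.subset_adjoin[of K n f]
      by (auto simp: restrict_terms_add)
  next
    case False
    hence "component d (f * c) = f * component (d - e) c"
      using component_mult[OF assms(3), of "d - e"] by simp
    thus ?thesis using ac a restrict_terms_closed by (auto simp: restrict_terms_add intro: polys.adjoinI)
  qed
qed

text \<open>In the graded setting a regular sequence stays regular without its first entry \<open>x\<close>. If
  \<open>f a \<in> K\<close>, then regularity of \<open>x, f\<close> lets one split off \<open>x\<close> from \<open>a\<close> modulo \<open>K\<close> again and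
  again, and the degree of \<open>x\<close> bounds this for every homogeneous component of \<open>a\<close>.\<close>

lemma weakly_regular_drop_first:
  assumes "polys.ideal_in n K" "graded K" "x \<in> polys n" "homogeneous e x" "e > 0"
    and "set fs \<subseteq> polys n" "\<And>f. f \<in> set fs \<Longrightarrow> \<exists>d. homogeneous d f"
    and "polys.weakly_regular n K (x # fs)"
  shows "polys.weakly_regular n K fs"
  using assms
proof (induction fs arbitrary: K)
  case (Cons f fs)
  note K = polys.ideal_inD[OF \<open>polys.ideal_in n K\<close>]
  have f: "f \<in> polys n" using Cons.prems by simp
  have x_nzd: "a \<in> K" if "a \<in> polys n" "x * a \<in> K" for a
    using Cons.prems(8) that by (auto simp: polys.colon_def)
  have f_nzd: "a \<in> polys.adjoin n K x" if "a \<in> polys n" "f * a \<in> polys.adjoin n K x" for a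
    using Cons.prems(8) that by (auto simp: polys.colon_def)
  have "polys.colon n K f \<subseteq> K"
  proof
    fix a assume "a \<in> polys.colon n K f"
    hence a: "a \<in> polys n" "f * a \<in> K" by (auto simp: polys.colon_def)
    have split: "\<exists>b\<in>polys n. a - x ^ t * b \<in> K \<and> f * b \<in> K" for t
    proof (induction t)
      case 0
      show ?case using a K(2) by (intro bexI[of _ a]) auto
    next
      case (Suc t)
      then obtain b where b: "b \<in> polys n" "a - x ^ t * b \<in> K" "f * b \<in> K" by blast
      then obtain k c where kc: "k \<in> K" "c \<in> polys n" "b = k + x * c"
        using f_nzd[of b] polys.subset_adjoin[of K n x] by (blast elim: polys.adjoinE)
      have "x * (f * c) = f * b - f * k" using kc by (simp add: algebra_simps)
      also have "\<dots> \<in> K" using K(7)[OF b(3) K(4)[OF f kc(1)]] .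
      finally have "f * c \<in> K" using x_nzd polys.mult_closed[OF f kc(2)] by blast
      moreover have "a - x ^ Suc t * c = (a - x ^ t * b) + x ^ t * k"
        using kc by (simp add: algebra_simps)
      hence "a - x ^ Suc t * c \<in> K"
        using K(3)[OF b(2) K(4)[OF polys.power_closed[OF Cons.prems(3)] kc(1)]] by metis
      ultimately show ?case using kc by blast
    qed
    show "a \<in> K"
    proof (rule graded_memI[OF Cons.prems(1)])
      fix d
      obtain b where b: "a - x ^ Suc d * b \<in> K" using split by blast
      have "d < Suc d * e" using \<open>e > 0\<close> by (cases e) auto
      hence "component d (x ^ Suc d * b) = 0"
        by (rule component_mult_low[OF homogeneous_power[OF Cons.prems(4)]])
      hence "component d a = component d (a - x ^ Suc d * b)"
        using restrict_terms_add[of _ "a - x ^ Suc d * b" "x ^ Suc d * b"]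
        by (simp del: power_Suc)
      thus "component d a \<in> K" using b Cons.prems(2) by (simp add: graded_def)
    qed
  qed
  moreover have "polys.weakly_regular n (polys.adjoin n K f) fs"
  proof (rule Cons.IH)
    have "polys.colon n (polys.adjoin n K f) x \<subseteq> polys.adjoin n K f"
    proof
      fix z assume "z \<in> polys.colon n (polys.adjoin n K f) x"
      then obtain k c where z: "z \<in> polys n" "k \<in> K" "c \<in> polys n" "x * z = k + f * c"
        by (auto simp: polys.colon_def elim!: polys.adjoinE)
      have "f * c = - k + x * z" using z by simp
      also have "\<dots> \<in> polys.adjoin n K x" using z K(6) by (intro polys.adjoinI) auto
      finally obtain k' e where k': "k' \<in> K" "e \<in> polys n" "c = k' + x * e"
        using f_nzd[OF z(3)] by (blast elim: polys.adjoinE)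
      have "x * (z - f * e) = k + f * k'" using z k' by (simp add: algebra_simps)
      also have "\<dots> \<in> K" using K(3)[OF z(2) K(4)[OF f k'(1)]] .
      finally have "z - f * e \<in> K"
        using x_nzd polys.diff_closed[OF z(1) polys.mult_closed[OF f k'(2)]] by blast
      from polys.adjoinI[OF this k'(2), of f] show "z \<in> polys.adjoin n K f" by simp
    qed
    thus "polys.weakly_regular n (polys.adjoin n K f) (x # fs)"
      using Cons.prems(8) polys.adjoin_commute[of n K f x] by simp
    obtain d where "homogeneous d f" using Cons.prems(7)[of f] by auto
    thus "graded (polys.adjoin n K f)" using graded_adjoin Cons.prems by blast
    show "polys.ideal_in n (polys.adjoin n K f)"
      using polys.ideal_in_adjoin Cons.prems(1) f by blast
  qed (use Cons.prems in auto)
  ultimately show ?case by simp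
qed simp

section \<open>Polynomials outnumbering their variables are algebraically dependent\<close>

interpretation mpoly: vector_space "\<lambda>(c::'k::field) (p::'k mpoly). single 0 c * p"
  by unfold_locales
    (simp_all add: distrib_left distrib_right single_add mult_single flip: mult.assoc)

lemma linear_relation:
  fixes g :: "'b \<Rightarrow> 'k::field mpoly"
  assumes "finite Y" "finite B" "card B < card Y" "g ` Y \<subseteq> mpoly.span B"
  obtains A c where "A \<subseteq> Y" "A \<noteq> {}" "\<And>a. a \<in> A \<Longrightarrow> c a \<noteq> 0" "(\<Sum>a\<in>A. single 0 (c a) * g a) = 0"
proof (cases "inj_on g Y")
  case False
  then obtain a b where ab: "a \<in> Y" "b \<in> Y" "a \<noteq> b" "g a = g b" by (auto simp: inj_on_def)
  show ?thesis
  proof (rule that[of "{a, b}" "\<lambda>x. if x = a then 1 else - 1"])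
    show "(\<Sum>x\<in>{a, b}. single 0 (if x = a then 1 else - 1) * g x) = 0"
      using ab by (simp add: single_uminus)
  qed (use ab in auto)
next
  case True
  have "mpoly.dependent (g ` Y)"
    using mpoly.independent_span_bound[OF assms(2) _ assms(4)] assms(3) card_image[OF True] by auto
  then obtain u v where u: "v \<in> g ` Y" "u v \<noteq> 0" "(\<Sum>v\<in>g ` Y. single 0 (u v) * v) = 0"
    using mpoly.dependent_finite[of "g ` Y"] assms(1) by auto
  show ?thesis
  proof (rule that[of "{a \<in> Y. u (g a) \<noteq> 0}" "\<lambda>a. u (g a)"])
    have "(\<Sum>a\<in>{a \<in> Y. u (g a) \<noteq> 0}. single 0 (u (g a)) * g a) = (\<Sum>a\<in>Y. single 0 (u (g a)) * g a)"
      using assms(1) by (intro sum.mono_neutral_left) auto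
    also have "\<dots> = 0" using u(3) by (simp add: sum.reindex[OF True])
    finally show "(\<Sum>a\<in>{a \<in> Y. u (g a) \<noteq> 0}. single 0 (u (g a)) * g a) = 0" .
  qed (use u in auto)
qed

definition bounded_monoms :: "nat set \<Rightarrow> nat \<Rightarrow> monom set" where
  "bounded_monoms G N = {w. keys w \<subseteq> G \<and> (\<forall>i. lookup w i \<le> N)}"

lemma finite_card_bounded_monoms:
  assumes "finite G"
  shows "finite (bounded_monoms G N)" "card (bounded_monoms G N) \<le> (N + 1) ^ card G"
proof -
  let ?f = "\<lambda>w :: monom. restrict (lookup w) G"
  let ?F = "G \<rightarrow>\<^sub>E {..N}"
  have "finite ?F" using assms by (intro finite_PiE) auto
  have inj: "inj_on ?f (bounded_monoms G N)"
  proof (rule inj_onI, rule poly_mapping_eqI)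
    fix v w i assume vw: "v \<in> bounded_monoms G N" "w \<in> bounded_monoms G N" "?f v = ?f w"
    show "lookup v i = lookup w i"
    proof (cases "i \<in> G")
      case True
      thus ?thesis using fun_cong[OF vw(3), of i] by simp
    next
      case False
      hence "i \<notin> keys v" "i \<notin> keys w" using vw by (auto simp: bounded_monoms_def)
      thus ?thesis by (simp add: in_keys_iff)
    qed
  qed
  have sub: "?f ` bounded_monoms G N \<subseteq> ?F" by (auto simp: bounded_monoms_def)
  show "finite (bounded_monoms G N)" using inj_on_finite[OF inj sub \<open>finite ?F\<close>] .
  have "card (bounded_monoms G N) \<le> card ?F" using card_inj_on_le[OF inj sub \<open>finite ?F\<close>] .
  thus "card (bounded_monoms G N) \<le> (N + 1) ^ card G" using assms by (simp add: card_PiE)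
qed

definition degree_le :: "nat \<Rightarrow> 'k::field mpoly \<Rightarrow> bool" where
  "degree_le D p \<longleftrightarrow> keys p \<subseteq> {w. mdeg w \<le> D}"

lemma degree_le_mult: "degree_le D p \<Longrightarrow> degree_le E q \<Longrightarrow> degree_le (D + E) (p * q)"
  using keys_mult[of p q] by (fastforce simp: degree_le_def mdeg_add)

lemma degree_le_power: "degree_le D p \<Longrightarrow> degree_le (k * D) (p ^ k)"
proof (induction k)
  case 0
  show ?case by (simp add: degree_le_def mdeg_def)
next
  case (Suc k)
  thus ?case using degree_le_mult[of D p "k * D"] by simp
qed

lemma degree_le_mono: "degree_le D p \<Longrightarrow> D \<le> E \<Longrightarrow> degree_le E p"
  by (auto simp: degree_le_def)

lemma degree_le_list_power:
  "(\<And>f. f \<in> set fs \<Longrightarrow> degree_le D f) \<Longrightarrow> set as \<subseteq> {..t} \<Longrightarrow> degree_le (length fs * (t * D)) (list_power fs as)"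
proof (induction fs arbitrary: as)
  case Nil
  thus ?case by (simp add: degree_le_def mdeg_def list_power_Nil)
next
  case (Cons f fs)
  show ?case
  proof (cases as)
    case Nil
    thus ?thesis by (simp add: degree_le_def mdeg_def list_power_def)
  next
    case (Cons a bs)
    have "degree_le (t * D) (f ^ a)"
      using Cons Cons.prems degree_le_mono[OF degree_le_power[of D f a], of "t * D"] by simp
    moreover have "degree_le (length fs * (t * D)) (list_power fs bs)"
      using Cons Cons.prems Cons.IH by simp
    ultimately show ?thesis
      using degree_le_mult Cons by (fastforce simp: list_power_Cons)
  qed
qed

lemma ex_degree_le:
  fixes fs :: "'k::field mpoly list"
  obtains D where "\<And>f. f \<in> set fs \<Longrightarrow> degree_le D f"
proof
  let ?M = "mdeg ` (\<Union>f\<in>set fs. keys f)"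
  show "degree_le (Max ?M) f" if "f \<in> set fs" for f
    using that by (auto simp: degree_le_def intro!: Max_ge)
qed

lemma restrict_terms_scale: "restrict_terms W (single 0 c * p) = single 0 c * restrict_terms W p"
proof (rule poly_mapping_eqI)
  have "lookup (single 0 c * q) w = c * lookup q w" for q :: "'a mpoly" and w
    by (simp add: lookup_mult lookup_single when_mult)
  thus "lookup (restrict_terms W (single 0 c * p)) w = lookup (single 0 c * restrict_terms W p) w" for w
    by (simp add: lookup_restrict_terms)
qed

lemma restrict_terms_face_list_power:
  fixes fs :: "'k::field mpoly list"
  shows "restrict_terms {w. keys w \<subseteq> G} (list_power fs as)
    = list_power (map (restrict_terms {w. keys w \<subseteq> G}) fs) as"
proof (induction fs arbitrary: as)
  have one: "restrict_terms {w. keys w \<subseteq> G} (1 :: 'k mpoly) = 1"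
    by (rule restrict_terms_id) simp
  {
    case Nil
    show ?case by (simp add: list_power_Nil one)
  next
    case (Cons f fs)
    have "restrict_terms {w. keys w \<subseteq> G} (f ^ k) = restrict_terms {w. keys w \<subseteq> G} f ^ k" for k
      by (induction k) (simp_all add: one restrict_terms_face_mult)
    thus ?case using Cons by (cases as) (simp_all add: list_power_def one restrict_terms_face_mult)
  }
qed

text \<open>With exponents below \<open>t\<close> there are \<open>t\<^sup>r\<close> power products of \<open>r\<close> polynomials of degree at
  most \<open>D\<close>. They lie in a space of dimension at most \<open>(r t D + 1)\<^sup>m\<close> if only \<open>m\<close> variables occur,
  and \<open>m < r\<close> makes this smaller than \<open>t\<^sup>r\<close> for large \<open>t\<close>.\<close>

lemma algebraic_relation:
  fixes fs :: "'k::field mpoly list"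
  assumes "finite G" "card G < length fs"
  obtains A c where "finite A" "A \<noteq> {}" "\<And>as. as \<in> A \<Longrightarrow> length as = length fs"
    "\<And>as. as \<in> A \<Longrightarrow> c as \<noteq> 0"
    "restrict_terms {w. keys w \<subseteq> G} (\<Sum>as\<in>A. single 0 (c as) * list_power fs as) = 0"
proof -
  let ?r = "length fs" and ?m = "card G" and ?W = "{w. keys w \<subseteq> G}"
  define gs where "gs = map (restrict_terms ?W) fs"
  obtain D where D: "\<And>f. f \<in> set gs \<Longrightarrow> degree_le D f"
    using ex_degree_le[of gs] by blast
  \<comment> \<open>large enough for \<open>(r t D + 1)\<^sup>m \<le> t\<^sup>m (r D + 1)\<^sup>m < t\<^bsup>m+1\<^esup>\<close>\<close>
  define t where "t = (?r * D + 1) ^ ?m + 1"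
  let ?N = "?r * (t * D)"
  define E where "E = {as. set as \<subseteq> {..<t} \<and> length as = ?r}"
  define B :: "'k mpoly set" where "B = monom_poly ` bounded_monoms G ?N"
  have "finite B" using finite_card_bounded_monoms[OF assms(1)] by (simp add: B_def)
  have "card B \<le> (?N + 1) ^ ?m"
    using card_image_le finite_card_bounded_monoms[OF assms(1)] le_trans unfolding B_def by blast
  also have "\<dots> \<le> (t * (?r * D + 1)) ^ ?m"
    by (rule power_mono) (simp_all add: t_def algebra_simps)
  also have "\<dots> = t ^ ?m * (?r * D + 1) ^ ?m" by (rule power_mult_distrib)
  also have "\<dots> < t ^ ?m * t"
    by (intro mult_strict_left_mono zero_less_power) (simp_all add: t_def)
  also have "\<dots> = t ^ Suc ?m" by simp
  also have "\<dots> \<le> t ^ ?r"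
    using assms(2) by (intro power_increasing) (auto simp: t_def)
  also have "\<dots> = card E"
    by (simp add: E_def card_lists_length_eq)
  finally have card: "card B < card E" .
  have fin: "finite E" unfolding E_def by (rule finite_lists_length_eq) simp
  have span: "list_power gs ` E \<subseteq> mpoly.span B"
  proof
    fix p assume "p \<in> list_power gs ` E"
    then obtain as where as: "set as \<subseteq> {..<t}" "p = list_power gs as" by (auto simp: E_def)
    have "degree_le (length gs * (t * D)) p"
      unfolding as(2) using D as(1) by (intro degree_le_list_power) auto
    moreover have "p = restrict_terms ?W (list_power fs as)"
      unfolding as(2) gs_def by (rule restrict_terms_face_list_power[symmetric])
    ultimately have *: "keys p \<subseteq> bounded_monoms G ?N"
      using le_trans[OF lookup_le_mdeg]
      by (fastforce simp: keys_restrict_terms bounded_monoms_def degree_le_def gs_def)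
    have "p = (\<Sum>w\<in>keys p. single 0 (lookup p w) * monom_poly w)"
      by (rule poly_mapping_eqI)
        (simp add: monom_poly_def mult_single lookup_sum lookup_single when_def in_keys_iff)
    also have "\<dots> \<in> mpoly.span B"
      using * by (intro mpoly.span_sum mpoly.span_scale mpoly.span_base) (auto simp: B_def)
    finally show "p \<in> mpoly.span B" .
  qed
  obtain A c where A: "A \<subseteq> E" "A \<noteq> {}" "\<And>as. as \<in> A \<Longrightarrow> c as \<noteq> 0"
    "(\<Sum>as\<in>A. single 0 (c as) * list_power gs as) = 0"
    by (rule linear_relation[OF fin \<open>finite B\<close> card span]) blast
  show thesis
  proof (rule that[of A c])
    show "restrict_terms ?W (\<Sum>as\<in>A. single 0 (c as) * list_power fs as) = 0"
      using A(4) by (simp add: restrict_terms_sum restrict_terms_scale restrict_terms_face_list_power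
          flip: gs_def)
    show "finite A" using A(1) fin by (rule finite_subset)
  qed (use A in \<open>auto simp: E_def\<close>)
qed

section \<open>Elementary symmetric polynomials on a complex with complete skeleton\<close>

definition esym :: "nat \<Rightarrow> nat \<Rightarrow> 'k::field mpoly" where
  "esym n j = (\<Sum>H | H \<subseteq> {1..n} \<and> card H = j. monom_poly (set_monom H))"

primrec esyms :: "nat \<Rightarrow> nat \<Rightarrow> 'k::field mpoly list" where
  "esyms n 0 = []"
| "esyms n (Suc m) = esym n (Suc m) # esyms n m"

lemma length_esyms: "length (esyms n m) = m"
  by (induction m) auto

lemma set_esyms: "set (esyms n m) = esym n ` {1..m}"
  by (induction m) (auto simp: atLeastAtMostSuc_conv)

lemma esym_closed: "esym n j \<in> polys n"
  unfolding esym_def by (intro polys.sum_closed set_monom_closed) simp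

lemma set_esyms_closed: "set (esyms n m) \<subseteq> polys n"
  by (auto simp: set_esyms esym_closed)

lemma homogeneous_esym: "homogeneous j (esym n j :: 'k::field mpoly)"
proof -
  let ?\<H> = "{H. H \<subseteq> {1..n} \<and> card H = j}"
  have "keys (esym n j :: 'k mpoly) \<subseteq> (\<Union>H\<in>?\<H>. {set_monom H})"
    using Poly_Mapping.keys_sum[of "\<lambda>H. monom_poly (set_monom H) :: 'k mpoly" ?\<H>]
    by (simp add: esym_def keys_monom_poly)
  also have "\<dots> \<subseteq> {w. mdeg w = j}"
    using mdeg_set_monom[OF finite_vertices] by auto
  finally show ?thesis by (simp add: homogeneous_def)
qed

lemma esym_cong_face:
  assumes "G \<subseteq> {1..n}"
  shows "esym n (card G) - monom_poly (set_monom G) \<in> (face_ideal n (Pow G) :: 'k::field mpoly set)"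
proof -
  let ?\<H> = "{H. H \<subseteq> {1..n} \<and> card H = card G}"
  have "esym n (card G) - monom_poly (set_monom G)
      = (\<Sum>H\<in>?\<H> - {G}. monom_poly (set_monom H) :: 'k mpoly)"
    unfolding esym_def using assms by (subst sum.remove[of _ G]) auto
  also have "\<dots> \<in> face_ideal n (Pow G)"
  proof -
    note ideal = ideal_in_face_ideal[OF down_closed_Pow, of n G, where 'k = 'k]
    have mem: "monom_poly (set_monom H) \<in> (face_ideal n (Pow G) :: 'k mpoly set)"
      if "H \<in> ?\<H> - {G}" for H
    proof -
      have "finite G" "finite H" using that assms finite_subset by blast+
      moreover from this have "\<not> H \<subseteq> G" using that card_subset_eq by blast
      ultimately show ?thesis
        using that by (simp add: face_ideal_def keys_monom_poly keys_set_monom monom_poly_closed)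
    qed
    have "sum f \<K> \<in> (face_ideal n (Pow G) :: 'k mpoly set)"
      if "\<forall>H\<in>\<K>. f H \<in> (face_ideal n (Pow G) :: 'k mpoly set)" for f and \<K> :: "nat set set"
      using that by (induction \<K> rule: infinite_finite_induct)
        (simp_all add: polys.ideal_inD(2)[OF ideal] polys.ideal_inD(3)[OF ideal])
    from this[OF ballI, OF mem] show ?thesis .
  qed
  finally show ?thesis .
qed

text \<open>On the simplex \<open>G\<close> the polynomial of degree \<open>|G|\<close> restricts to the monomial \<open>x\<^sub>G\<close>, a
  nonzerodivisor. Modulo \<open>x\<^sub>G\<close> what remains is the boundary of \<open>G\<close>; splitting off the variables of
  \<open>x\<^sub>G\<close> one at a time reduces it to the facets of \<open>G\<close>, where induction applies. Taking the
  polynomials by decreasing degree is what makes this work, and it works over any field.\<close>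

lemma weakly_regular_esyms_simplex:
  assumes "G \<subseteq> {1..n}" "card G = m"
  shows "polys.weakly_regular n (face_ideal n (Pow G) :: 'k::field mpoly set) (esyms n m)"
  using assms
proof (induction m arbitrary: G)
  case (Suc m)
  let ?P = "face_ideal n (Pow G) :: 'k mpoly set" and ?e = "esym n (Suc m) :: 'k mpoly"
  have fin: "finite G" using Suc.prems finite_subset by blast
  have ideal: "polys.ideal_in n ?P" by (rule ideal_in_face_ideal[OF down_closed_Pow])
  have x: "monom_poly (set_monom G) \<in> (polys n :: 'k mpoly set)"
    using Suc.prems fin by (simp add: monom_poly_closed keys_set_monom)
  have cong: "?e - monom_poly (set_monom G) \<in> ?P" using esym_cong_face[of G n] Suc.prems by simp
  have "monom_poly (set_monom G) \<notin> ?P"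
    using fin by (simp add: face_ideal_def keys_monom_poly keys_set_monom)
  hence "?e \<notin> ?P" using polys.ideal_inD(7)[OF ideal _ cong, of ?e] by auto
  hence "polys.colon n ?P ?e \<subseteq> ?P"
    using face_ideal_Pow_prime[of ?e _ n G] esym_closed[of n "Suc m"] by (auto simp: polys.colon_def)
  moreover have "polys.weakly_regular n (face_ideal n {A \<in> Pow G. \<not> H \<subseteq> A} :: 'k mpoly set) (esyms n m)"
    if "H \<noteq> {}" "H \<subseteq> G" for H
  proof -
    have facet: "polys.weakly_regular n (face_ideal n (Pow (G - {v})) :: 'k mpoly set) (esyms n m)"
      if "v \<in> G" for v
      using that Suc.prems by (intro Suc.IH) auto
    have "finite H" using that fin finite_subset by blast
    thus ?thesis using that
    proof (induction H rule: finite_ne_induct)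
      case (singleton v)
      have "{A \<in> Pow G. \<not> {v} \<subseteq> A} = Pow (G - {v})" by auto
      thus ?case using facet singleton by simp
    next
      case (insert v H)
      let ?\<Gamma> = "{A \<in> Pow G. \<not> insert v H \<subseteq> A}"
      show ?case
      proof (rule weakly_regular_face_ideal[of _ "{v}"])
        have "{A. A \<union> {v} \<in> ?\<Gamma>} = {A \<in> Pow G. \<not> H \<subseteq> A}"
          using insert.prems insert.hyps by auto
        thus "polys.weakly_regular n (face_ideal n {A. A \<union> {v} \<in> ?\<Gamma>} :: 'k mpoly set) (esyms n m)"
          using insert.IH insert.prems by simp
        have "{A \<in> ?\<Gamma>. \<not> {v} \<subseteq> A} = Pow (G - {v})" by auto
        thus "polys.weakly_regular n (face_ideal n {A \<in> ?\<Gamma>. \<not> {v} \<subseteq> A} :: 'k mpoly set) (esyms n m)"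
          using facet insert.prems by simp
      qed (use insert.prems Suc.prems in \<open>auto simp: down_closed_def set_esyms_closed\<close>)
    qed
  qed
  moreover have "polys.adjoin n ?P (monom_poly (set_monom G)) = face_ideal n {A \<in> Pow G. \<not> G \<subseteq> A}"
    by (rule adjoin_face_ideal[OF down_closed_Pow Suc.prems(1)])
  moreover have "G \<noteq> {}" using Suc.prems by auto
  ultimately have "polys.colon n ?P ?e \<subseteq> ?P"
    "polys.weakly_regular n (polys.adjoin n ?P (monom_poly (set_monom G))) (esyms n m)"
    by simp_all
  thus ?case
    using polys.adjoin_cong[OF ideal cong esym_closed x] by simp
qed simp

text \<open>The simplex with one more vertex has a regular sequence with one more entry, and the entry that
  comes first can be dropped.\<close>

lemma weakly_regular_esyms_larger_simplex:
  assumes "G \<subseteq> {1..n}" "card G = Suc m"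
  shows "polys.weakly_regular n (face_ideal n (Pow G) :: 'k::field mpoly set) (esyms n m)"
proof (rule weakly_regular_drop_first)
  show "polys.weakly_regular n (face_ideal n (Pow G) :: 'k mpoly set) (esym n (Suc m) # esyms n m)"
    using weakly_regular_esyms_simplex[OF assms] by simp
  show "\<exists>d. homogeneous d f" if "f \<in> set (esyms n m :: 'k mpoly list)" for f
    using that homogeneous_esym by (auto simp: set_esyms)
  show "homogeneous (Suc m) (esym n (Suc m) :: 'k mpoly)" by (rule homogeneous_esym)
qed (simp_all add: ideal_in_face_ideal down_closed_Pow graded_face_ideal esym_closed
    set_esyms_closed)

text \<open>Link and deletion of a vertex of \<open>V\<close> in the join of the simplex \<open>W\<close> with a skeleton of
  \<open>V\<close> are again such joins. At the end only simplices with \<open>|W| + m\<close> vertices are left.\<close>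

lemma weakly_regular_esyms_skeleton:
  assumes "finite V" "W \<inter> V = {}" "W \<union> V \<subseteq> {1..n}" "m \<le> card V"
  shows "polys.weakly_regular n
    (face_ideal n {A. A \<subseteq> W \<union> V \<and> card (A \<inter> V) \<le> m} :: 'k::field mpoly set) (esyms n (card W + m))"
  using assms
proof (induction V arbitrary: W m rule: finite_induct)
  case empty
  have "{A. A \<subseteq> W \<union> {} \<and> card (A \<inter> {}) \<le> m} = Pow W" by auto
  thus ?case using weakly_regular_esyms_simplex[of W n] empty by simp
next
  case (insert v V)
  let ?\<Gamma> = "\<lambda>W V m. {A. A \<subseteq> W \<union> V \<and> card (A \<inter> V) \<le> m}"
  have finW: "finite W" using insert.prems finite_subset by blast
  consider "m = 0" | "m = Suc (card V)" | k where "m = Suc k" "m \<le> card V"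
    using insert by (cases m) (auto simp: le_Suc_eq)
  thus ?case
  proof cases
    case 1
    have "?\<Gamma> W (insert v V) m = Pow W" using 1 insert.hyps(1) insert.prems(1)
      by (auto simp: card_eq_0_iff)
    thus ?thesis using weakly_regular_esyms_simplex[of W n] insert.prems(2) 1 by simp
  next
    case 2
    have "card (A \<inter> insert v V) \<le> m" for A
      using card_mono[of "insert v V" "A \<inter> insert v V"] insert.hyps 2 by simp
    hence "?\<Gamma> W (insert v V) m = Pow (W \<union> insert v V)" by auto
    moreover have "card (W \<union> insert v V) = card W + m"
      using insert.hyps insert.prems(1) 2 finW by (subst card_Un_disjoint) auto
    ultimately show ?thesis using weakly_regular_esyms_simplex[OF insert.prems(2)] by simp
  next
    case 3
    show ?thesis
    proof (rule weakly_regular_face_ideal[of _ "{v}"])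
      have "B \<in> ?\<Gamma> W (insert v V) m" if "A \<in> ?\<Gamma> W (insert v V) m" "B \<subseteq> A" for A B
      proof -
        have "card (B \<inter> insert v V) \<le> card (A \<inter> insert v V)"
          using insert.hyps that(2) by (intro card_mono) auto
        also have "\<dots> \<le> m" using that(1) by blast
        finally show ?thesis using that by blast
      qed
      thus "down_closed (?\<Gamma> W (insert v V) m)" unfolding down_closed_def by blast
      have "card ((A \<union> {v}) \<inter> insert v V) = Suc (card (A \<inter> V))" for A
      proof -
        have "(A \<union> {v}) \<inter> insert v V = insert v (A \<inter> V)" by auto
        thus ?thesis using insert.hyps by simp
      qed
      hence "{A. A \<union> {v} \<in> ?\<Gamma> W (insert v V) m} = ?\<Gamma> (insert v W) V k"
        using 3 by auto
      moreover have "card (insert v W) + k = card W + m" using finW insert.prems(1) 3 by simp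
      moreover have "polys.weakly_regular n (face_ideal n (?\<Gamma> (insert v W) V k) :: 'k mpoly set)
          (esyms n (card (insert v W) + k))"
        using insert.prems insert.hyps 3 by (intro insert.IH) auto
      ultimately show "polys.weakly_regular n
          (face_ideal n {A. A \<union> {v} \<in> ?\<Gamma> W (insert v V) m} :: 'k mpoly set) (esyms n (card W + m))"
        by simp
      have "{A \<in> ?\<Gamma> W (insert v V) m. \<not> {v} \<subseteq> A} = ?\<Gamma> W V m"
      proof (rule Collect_cong)
        fix A
        have "A \<inter> insert v V = A \<inter> V" if "v \<notin> A" using that by auto
        moreover have "v \<notin> W \<union> V" using insert.hyps insert.prems by auto
        ultimately show "(A \<in> ?\<Gamma> W (insert v V) m \<and> \<not> {v} \<subseteq> A)
            \<longleftrightarrow> (A \<subseteq> W \<union> V \<and> card (A \<inter> V) \<le> m)"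
          by (cases "v \<in> A") auto
      qed
      thus "polys.weakly_regular n
          (face_ideal n {A \<in> ?\<Gamma> W (insert v V) m. \<not> {v} \<subseteq> A} :: 'k mpoly set) (esyms n (card W + m))"
        by (simp only:) (rule insert.IH; use insert.prems 3 in auto)
    qed (use insert.prems in \<open>simp_all add: set_esyms_closed\<close>)
  qed
qed

text \<open>Adding a face \<open>G\<close> with \<open>m + 1\<close> elements to the complex enlarges the face ring by a copy
  of the polynomial ring in the variables of \<open>G\<close>.\<close>

lemma weakly_regular_esyms_complex:
  assumes "m \<le> n" "\<And>A. A \<subseteq> {1..n} \<Longrightarrow> card A \<le> m \<Longrightarrow> A \<in> \<Gamma>"
    and "\<And>A. A \<in> \<Gamma> \<Longrightarrow> A \<subseteq> {1..n} \<and> card A \<le> Suc m"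
  shows "polys.weakly_regular n (face_ideal n \<Gamma> :: 'k::field mpoly set) (esyms n m)"
proof -
  define Sk where "Sk = {A. A \<subseteq> {1..n} \<and> card A \<le> m}"
  have fin: "finite A" if "A \<subseteq> {1..n}" for A using that finite_subset by blast
  have add_faces: "polys.weakly_regular n (face_ideal n (Sk \<union> \<F>) :: 'k mpoly set) (esyms n m)"
    if "finite \<F>" "\<F> \<subseteq> {A. A \<subseteq> {1..n} \<and> card A = Suc m}" for \<F>
    using that
  proof (induction \<F> rule: finite_induct)
    case empty
    have "Sk = {A. A \<subseteq> {} \<union> {1..n} \<and> card (A \<inter> {1..n}) \<le> m}"
      by (auto simp: Sk_def Int_absorb2)
    thus ?case using weakly_regular_esyms_skeleton[of "{1..n}" "{}" n m] assms by simp
  next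
    case (insert G \<F>)
    let ?\<Delta> = "Sk \<union> insert G \<F>"
    have G: "G \<subseteq> {1..n}" "card G = Suc m" using insert by auto
    have eq: "A = G" if "A \<in> ?\<Delta>" "G \<subseteq> A" for A
    proof -
      have A: "A \<subseteq> {1..n}" "card A \<le> Suc m" using that insert.prems by (auto simp: Sk_def)
      thus ?thesis using card_seteq[OF fin[OF A(1)] that(2)] G by simp
    qed
    show ?case
    proof (rule weakly_regular_face_ideal[of _ G])
      show "down_closed ?\<Delta>"
        unfolding down_closed_def
      proof (intro ballI allI impI)
        fix A B assume AB: "A \<in> ?\<Delta>" "B \<subseteq> A"
        have A: "A \<subseteq> {1..n}" "card A \<le> Suc m" using AB insert.prems by (auto simp: Sk_def)
        show "B \<in> ?\<Delta>"
        proof (cases "B = A")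
          case False
          hence "card B < card A" using AB A fin by (intro psubset_card_mono) auto
          thus ?thesis using A AB by (auto simp: Sk_def)
        qed (use AB in simp)
      qed
      have "{A. A \<union> G \<in> ?\<Delta>} = Pow G"
        using eq by (fastforce simp: Un_absorb1)
      thus "polys.weakly_regular n (face_ideal n {A. A \<union> G \<in> ?\<Delta>} :: 'k mpoly set) (esyms n m)"
        using weakly_regular_esyms_larger_simplex[OF G] by simp
      have "G \<notin> Sk" using G by (simp add: Sk_def)
      hence "{A \<in> ?\<Delta>. \<not> G \<subseteq> A} = Sk \<union> \<F>"
        using eq insert.hyps by blast
      thus "polys.weakly_regular n (face_ideal n {A \<in> ?\<Delta>. \<not> G \<subseteq> A} :: 'k mpoly set) (esyms n m)"
        using insert by simp
    qed (use G in \<open>simp_all add: set_esyms_closed\<close>)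
  qed
  have "polys.weakly_regular n
      (face_ideal n (Sk \<union> {A \<in> \<Gamma>. card A = Suc m}) :: 'k mpoly set) (esyms n m)"
  proof (rule add_faces)
    have "{A \<in> \<Gamma>. card A = Suc m} \<subseteq> Pow {1..n}" using assms(3) by blast
    thus "finite {A \<in> \<Gamma>. card A = Suc m}" by (rule finite_subset) simp
    show "{A \<in> \<Gamma>. card A = Suc m} \<subseteq> {A. A \<subseteq> {1..n} \<and> card A = Suc m}"
      using assms(3) by blast
  qed
  moreover have "Sk \<union> {A \<in> \<Gamma>. card A = Suc m} = \<Gamma>"
  proof (intro equalityI subsetI)
    fix A assume "A \<in> \<Gamma>"
    thus "A \<in> Sk \<union> {A \<in> \<Gamma>. card A = Suc m}"
      using assms(3)[of A] by (auto simp: Sk_def le_Suc_eq)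
  next
    fix A assume "A \<in> Sk \<union> {A \<in> \<Gamma>. card A = Suc m}"
    thus "A \<in> \<Gamma>" using assms(2)[of A] by (auto simp: Sk_def)
  qed
  ultimately show ?thesis by simp
qed

section \<open>Ideals of quotient rings\<close>

lemma ideal_iff: "ideal K (polynomial_ring n) \<longleftrightarrow> polys.ideal_in n (K :: 'k::field mpoly set)"
proof
  interpret R: cring "polynomial_ring n :: 'k mpoly ring" by (rule cring_polynomial_ring)
  {
    assume "ideal K (polynomial_ring n)"
    then interpret ideal K "polynomial_ring n" .
    have "0 \<in> K" "\<forall>a\<in>K. \<forall>b\<in>K. a + b \<in> K" "\<forall>c\<in>polys n. \<forall>a\<in>K. c * a \<in> K"
      using zero_closed a_closed I_l_closed by (simp_all add: polynomial_ring_ops)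
    thus "polys.ideal_in n K" using a_subset by (simp add: polys.ideal_in_def)
  next
    assume K: "polys.ideal_in n K"
    show "ideal K (polynomial_ring n)"
    proof (rule idealI[OF R.ring_axioms])
      show "subgroup K (add_monoid (polynomial_ring n))"
      proof (rule R.add.subgroupI)
        show "\<ominus>\<^bsub>polynomial_ring n\<^esub> a \<in> K" if "a \<in> K" for a
        proof -
          have "\<ominus>\<^bsub>polynomial_ring n\<^esub> a = - a"
            using polys.ideal_inD(1)[OF K that]
            by (intro R.minus_equality) (simp_all add: polynomial_ring_ops polys.uminus_closed)
          thus ?thesis using polys.ideal_inD(6)[OF K that] by simp
        qed
      qed (use K in \<open>auto simp: polynomial_ring_ops polys.ideal_in_def\<close>)
    qed (use polys.ideal_inD(4,5)[OF K] in \<open>simp_all add: polynomial_ring_ops\<close>)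
  }
qed

text \<open>Chains are counted above a given ideal \<open>M\<close>, so that the correspondence between the ideals of a
  quotient ring and the ideals above its kernel can be applied repeatedly.\<close>

definition ideal_chain :: "('a, 'b) ring_scheme \<Rightarrow> 'a set \<Rightarrow> nat \<Rightarrow> bool" where
  "ideal_chain R M l \<longleftrightarrow> (\<exists>H :: nat \<Rightarrow> 'a set.
     (\<forall>i\<le>l. ideal (H i) R \<and> M \<subseteq> H i) \<and> (\<forall>i<l. H i \<subset> H (Suc i)))"

locale quotient_ring = cring R + ideal I R for I and R (structure)
begin

abbreviation proj :: "'a \<Rightarrow> 'a set" where
  "proj \<equiv> (+>) I"

definition preimage :: "'a set set \<Rightarrow> 'a set" where
  "preimage L = {a \<in> carrier R. proj a \<in> L}"

lemmas proj_mult = ring_hom_mult[OF rcos_ring_hom]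

lemma carrier_Quot: "carrier (R Quot I) = proj ` carrier R"
  by (auto simp: FactRing_def A_RCOSETS_def')

lemma proj_eq_iff: "a \<in> carrier R \<Longrightarrow> b \<in> carrier R \<Longrightarrow> proj a = proj b \<longleftrightarrow> a \<ominus> b \<in> I"
  using quotient_eq_iff_same_a_r_cos[OF ideal_axioms] by simp

lemma zero_Quot: "\<zero>\<^bsub>R Quot I\<^esub> = I"
  by (simp add: FactRing_def)

lemma proj_mem: "a \<in> I \<Longrightarrow> proj a = I"
  using a_rcos_zero[OF ideal_axioms] .

lemma proj_mem_image_iff:
  assumes "ideal K R" "I \<subseteq> K" "a \<in> carrier R"
  shows "proj a \<in> proj ` K \<longleftrightarrow> a \<in> K"
proof
  interpret K: ideal K R by fact
  assume "proj a \<in> proj ` K"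
  then obtain b where b: "b \<in> K" "proj a = proj b" by auto
  hence "a \<ominus> b \<in> K" using proj_eq_iff assms K.Icarr by blast
  hence "(a \<ominus> b) \<oplus> b \<in> K" using b K.a_closed by blast
  moreover have "(a \<ominus> b) \<oplus> b = a"
    using assms b K.Icarr by (simp add: minus_eq a_assoc l_neg)
  ultimately show "a \<in> K" by simp
qed simp

lemma ideal_image: "ideal K R \<Longrightarrow> ideal (proj ` K) (R Quot I)"
  using ring_ideal_imp_quot_ideal[OF ideal_axioms] .

lemma ideal_preimage: "ideal L (R Quot I) \<Longrightarrow> ideal (preimage L) R"
  unfolding preimage_def by (rule ring_hom_ring.ideal_vimage[OF rcos_ring_hom_ring])

lemma subset_preimage: "ideal L (R Quot I) \<Longrightarrow> I \<subseteq> preimage L"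
  using additive_subgroup.zero_closed[OF ideal.axioms(1)] Icarr proj_mem zero_Quot
  by (fastforce simp: preimage_def)

lemma image_preimage: "ideal L (R Quot I) \<Longrightarrow> proj ` preimage L = L"
  using ideal.Icarr carrier_Quot by (fastforce simp: preimage_def)

lemma preimage_image:
  assumes "ideal K R" "I \<subseteq> K"
  shows "preimage (proj ` K) = K"
proof (intro equalityI subsetI)
  fix a assume "a \<in> preimage (proj ` K)"
  thus "a \<in> K" using proj_mem_image_iff[OF assms, of a] unfolding preimage_def by blast
next
  fix a assume "a \<in> K"
  thus "a \<in> preimage (proj ` K)" using ideal.Icarr[OF assms(1)] by (simp add: preimage_def)
qed

lemma preimage_strict_mono:
  assumes "ideal L (R Quot I)" "ideal L' (R Quot I)" "L \<subset> L'"
  shows "preimage L \<subset> preimage L'"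
proof -
  have "preimage L \<subseteq> preimage L'" using assms by (auto simp: preimage_def)
  moreover have "preimage L \<noteq> preimage L'" using assms image_preimage by (metis psubset_eq)
  ultimately show ?thesis by blast
qed

lemma image_strict_mono:
  assumes "ideal K R" "ideal K' R" "I \<subseteq> K" "I \<subseteq> K'" "K \<subset> K'"
  shows "proj ` K \<subset> proj ` K'"
proof -
  have "proj ` K \<noteq> proj ` K'" using assms preimage_image by (metis psubset_eq)
  thus ?thesis using assms(5) by blast
qed

lemma ideal_chain_Quot:
  assumes "ideal M R" "I \<subseteq> M"
  shows "ideal_chain (R Quot I) (proj ` M) l \<longleftrightarrow> ideal_chain R M l"
proof
  assume "ideal_chain (R Quot I) (proj ` M) l"
  then obtain H where H: "\<And>i. i \<le> l \<Longrightarrow> ideal (H i) (R Quot I) \<and> proj ` M \<subseteq> H i"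
    "\<And>i. i < l \<Longrightarrow> H i \<subset> H (Suc i)" by (auto simp: ideal_chain_def)
  have "ideal (preimage (H i)) R \<and> M \<subseteq> preimage (H i)" if "i \<le> l" for i
    using H(1)[OF that] ideal_preimage ideal.Icarr[OF assms(1)] by (auto simp: preimage_def)
  moreover have "preimage (H i) \<subset> preimage (H (Suc i))" if "i < l" for i
    using H(1)[of i] H(1)[of "Suc i"] H(2)[OF that] that preimage_strict_mono by simp
  ultimately show "ideal_chain R M l"
    unfolding ideal_chain_def by (intro exI[of _ "\<lambda>i. preimage (H i)"]) blast
next
  assume "ideal_chain R M l"
  then obtain H where H: "\<And>i. i \<le> l \<Longrightarrow> ideal (H i) R \<and> M \<subseteq> H i"
    "\<And>i. i < l \<Longrightarrow> H i \<subset> H (Suc i)" by (auto simp: ideal_chain_def)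
  have "ideal (proj ` H i) (R Quot I) \<and> proj ` M \<subseteq> proj ` H i" if "i \<le> l" for i
    using H(1)[OF that] ideal_image by blast
  moreover have "proj ` H i \<subset> proj ` H (Suc i)" if i: "i < l" for i
  proof (rule image_strict_mono)
    show "ideal (H i) R" "ideal (H (Suc i)) R" using H(1)[of i] H(1)[of "Suc i"] i by simp_all
    show "I \<subseteq> H i" "I \<subseteq> H (Suc i)" using H(1)[of i] H(1)[of "Suc i"] i assms(2) by auto
  qed (rule H(2)[OF i])
  ultimately show "ideal_chain (R Quot I) (proj ` M) l"
    unfolding ideal_chain_def by (intro exI[of _ "\<lambda>i. proj ` H i"]) blast
qed

lemma ring_length_Quot: "ring_length (R Quot I) = Sup {enat l | l. ideal_chain R I l}"
proof -
  have "proj ` I \<subseteq> L" if "ideal L (R Quot I)" for L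
    using subset_preimage[OF that] by (auto simp: preimage_def)
  hence "ideal L (R Quot I) \<and> proj ` I \<subseteq> L \<longleftrightarrow> ideal L (R Quot I)" for L by blast
  hence "ideal_chain (R Quot I) (proj ` I) l \<longleftrightarrow> (\<exists>H. (\<forall>i\<le>l. ideal (H i) (R Quot I))
      \<and> (\<forall>i<l. H i \<subset> H (Suc i)))" for l
    by (simp only: ideal_chain_def)
  thus ?thesis using ideal_chain_Quot[OF ideal_axioms subset_refl]
    by (simp add: ring_length_def)
qed

lemma primeideal_preimage: "primeideal P (R Quot I) \<Longrightarrow> primeideal (preimage P) R"
  unfolding preimage_def by (rule ring_hom_ring.primeideal_vimage[OF rcos_ring_hom_ring cring_axioms])

lemma primeideal_image:
  assumes "primeideal P R" "I \<subseteq> P"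
  shows "primeideal (proj ` P) (R Quot I)"
proof -
  interpret P: primeideal P R by fact
  note mem = proj_mem_image_iff[OF P.ideal_axioms assms(2)]
  show ?thesis
  proof (rule primeidealI)
    show "ideal (proj ` P) (R Quot I)" by (rule ideal_image[OF P.ideal_axioms])
    show "cring (R Quot I)" by (rule quotient_is_cring[OF cring_axioms])
    have "proj \<one> \<notin> proj ` P" using mem[of \<one>] P.I_notcarr P.one_imp_carrier by auto
    thus "carrier (R Quot I) \<noteq> proj ` P" unfolding carrier_Quot by (metis imageI one_closed)
    fix x y assume xy: "x \<in> carrier (R Quot I)" "y \<in> carrier (R Quot I)"
      "x \<otimes>\<^bsub>R Quot I\<^esub> y \<in> proj ` P"
    then obtain a b where ab: "a \<in> carrier R" "b \<in> carrier R" "x = proj a" "y = proj b"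
      by (auto simp: carrier_Quot)
    hence "proj (a \<otimes> b) \<in> proj ` P" using xy by (simp add: proj_mult)
    hence "a \<otimes> b \<in> P" using mem ab by simp
    thus "x \<in> proj ` P \<or> y \<in> proj ` P" using P.I_prime ab by blast
  qed
qed

end

lemma (in cring) ring_length_Quot_Quot:
  assumes "ideal I R" "ideal M R" "I \<subseteq> M"
  shows "ring_length ((R Quot I) Quot ((+>) I ` M)) = Sup {enat l | l. ideal_chain R M l}"
proof -
  interpret Q: quotient_ring I R using assms(1) cring_axioms by (simp add: quotient_ring_def)
  interpret QQ: quotient_ring "(+>) I ` M" "R Quot I"
    using Q.quotient_is_cring[OF cring_axioms] Q.ideal_image[OF assms(2)]
    by (simp add: quotient_ring_def)
  show ?thesis by (simp add: QQ.ring_length_Quot Q.ideal_chain_Quot[OF assms(2,3)])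
qed

lemma Sup_enat_eqI:
  assumes "P m" "\<And>l. P l \<Longrightarrow> l \<le> m"
  shows "Sup {enat l | l. P l} = enat m"
  using assms by (intro antisym Sup_least Sup_upper) auto

lemma quotient_ring_polys:
  "polys.ideal_in n I \<Longrightarrow> quotient_ring I (polynomial_ring n :: 'k::field mpoly ring)"
  using cring_polynomial_ring by (auto simp: quotient_ring_def ideal_iff)

section \<open>Regular sequences in the quotient by an ideal\<close>

lemma Idl_Quot:
  fixes I :: "'k::field mpoly set"
  assumes I: "polys.ideal_in n I" and gs: "set gs \<subseteq> polys n"
  shows "Idl\<^bsub>polynomial_ring n Quot I\<^esub> (((+>\<^bsub>polynomial_ring n\<^esub>) I) ` set gs)
    = ((+>\<^bsub>polynomial_ring n\<^esub>) I) ` polys.adjoin_list n I gs" (is "?L = ?R")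
proof
  interpret Q: quotient_ring I "polynomial_ring n :: 'k mpoly ring" by (rule quotient_ring_polys[OF I])
  note K = polys.ideal_in_adjoin_list[OF I gs]
  show "?L \<subseteq> ?R"
    using K polys.set_subset_adjoin_list[OF I gs]
    by (intro ring.genideal_minimal[OF Q.quotient_is_ring] Q.ideal_image) (auto simp: ideal_iff)
  have sub: "Q.proj ` set gs \<subseteq> carrier (polynomial_ring n Quot I)"
    using gs by (auto simp: Q.carrier_Quot)
  note L = ring.genideal_ideal[OF Q.quotient_is_ring sub]
  have "polys.adjoin_list n I gs \<subseteq> Q.preimage ?L"
  proof (rule polys.adjoin_list_least)
    show "polys.ideal_in n (Q.preimage ?L)" using Q.ideal_preimage[OF L] by (simp add: ideal_iff)
    show "I \<subseteq> Q.preimage ?L" by (rule Q.subset_preimage[OF L])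
    show "set gs \<subseteq> Q.preimage ?L"
      using gs ring.genideal_self[OF Q.quotient_is_ring sub] by (auto simp: Q.preimage_def)
  qed
  thus "?R \<subseteq> ?L" by (auto simp: Q.preimage_def)
qed

lemma regular_sequence_Quot_iff:
  fixes I :: "'k::field mpoly set"
  assumes I: "polys.ideal_in n I" and gs: "set gs \<subseteq> polys n"
  shows "regular_sequence (polynomial_ring n Quot I) (map ((+>\<^bsub>polynomial_ring n\<^esub>) I) gs)
    \<longleftrightarrow> polys.weakly_regular n I gs \<and> 1 \<notin> polys.adjoin_list n I gs"
proof -
  interpret Q: quotient_ring I "polynomial_ring n :: 'k mpoly ring" by (rule quotient_ring_polys[OF I])
  let ?Q = "polynomial_ring n Quot I"
  have Idl: "Idl\<^bsub>?Q\<^esub> (set (take i (map Q.proj gs))) = Q.proj ` polys.adjoin_list n I (take i gs)" for i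
    using Idl_Quot[OF I, of "take i gs"] gs set_take_subset[of i gs] by (simp add: take_map)
  have mem: "Q.proj a \<in> Q.proj ` polys.adjoin_list n I (take i gs) \<longleftrightarrow> a \<in> polys.adjoin_list n I (take i gs)"
    if "a \<in> polys n" for a i
    using that I polys.ideal_in_adjoin_list[OF I, of "take i gs"] gs set_take_subset[of i gs]
    by (intro Q.proj_mem_image_iff polys.subset_adjoin_list) (auto simp: ideal_iff)
  have "(\<forall>a\<in>carrier ?Q. map Q.proj gs ! i \<otimes>\<^bsub>?Q\<^esub> a \<in> Idl\<^bsub>?Q\<^esub> (set (take i (map Q.proj gs)))
        \<longrightarrow> a \<in> Idl\<^bsub>?Q\<^esub> (set (take i (map Q.proj gs))))
      \<longleftrightarrow> polys.colon n (polys.adjoin_list n I (take i gs)) (gs ! i) \<subseteq> polys.adjoin_list n I (take i gs)"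
    if i: "i < length gs" for i
  proof -
    have g: "gs ! i \<in> polys n" using gs i nth_mem by blast
    have "map Q.proj gs ! i \<otimes>\<^bsub>?Q\<^esub> Q.proj a = Q.proj (gs ! i * a)" if "a \<in> polys n" for a
      using Q.proj_mult[OF g that] i by (simp add: polynomial_ring_ops)
    thus ?thesis unfolding Idl Q.carrier_Quot
      using mem g polys.mult_closed[OF g] by (auto simp: polys.colon_def)
  qed
  moreover have "set (map Q.proj gs) \<subseteq> carrier ?Q" using gs by (auto simp: Q.carrier_Quot)
  moreover have "Idl\<^bsub>?Q\<^esub> (set (map Q.proj gs)) \<noteq> carrier ?Q \<longleftrightarrow> 1 \<notin> polys.adjoin_list n I gs"
  proof -
    note K = polys.ideal_in_adjoin_list[OF I gs]
    have "Idl\<^bsub>?Q\<^esub> (set (map Q.proj gs)) = Q.proj ` polys.adjoin_list n I gs"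
      using Idl[of "length gs"] by simp
    moreover have "Q.proj ` polys.adjoin_list n I gs = carrier ?Q \<longleftrightarrow> 1 \<in> polys.adjoin_list n I gs"
    proof
      assume "Q.proj ` polys.adjoin_list n I gs = carrier ?Q"
      hence "Q.proj 1 \<in> Q.proj ` polys.adjoin_list n I gs"
        using imageI[OF polys.one_closed, of Q.proj n] by (simp add: Q.carrier_Quot)
      thus "1 \<in> polys.adjoin_list n I gs" using mem[OF polys.one_closed, of "length gs"] by simp
    next
      assume "1 \<in> polys.adjoin_list n I gs"
      hence "p \<in> polys.adjoin_list n I gs" if "p \<in> polys n" for p
        using polys.ideal_inD(4)[OF K that] by fastforce
      thus "Q.proj ` polys.adjoin_list n I gs = carrier ?Q"
        using polys.ideal_inD(1)[OF K] by (auto simp: Q.carrier_Quot)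
    qed
    ultimately show ?thesis by simp
  qed
  ultimately show ?thesis by (auto simp: regular_sequence_def polys.weakly_regular_iff)
qed

section \<open>Powers of the irrelevant ideal\<close>

text \<open>The preimage in the polynomial ring of the \<open>t\<close>-th power of the irrelevant ideal; see
  \<open>ideal_power_irrelevant\<close>.\<close>

definition degree_ideal :: "nat \<Rightarrow> nat set set \<Rightarrow> nat \<Rightarrow> 'k::field mpoly set" where
  "degree_ideal n \<Gamma> t = {p \<in> polys n. keys p \<subseteq> {w. keys w \<notin> \<Gamma> \<or> t \<le> mdeg w}}"

lemma monom_poly_mem_degree_ideal:
  "keys w \<subseteq> {1..n} \<Longrightarrow> t \<le> mdeg w \<Longrightarrow> monom_poly w \<in> degree_ideal n \<Gamma> t"
  by (simp add: degree_ideal_def keys_monom_poly monom_poly_closed)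

lemma ideal_in_degree_ideal: "down_closed \<Gamma> \<Longrightarrow> polys.ideal_in n (degree_ideal n \<Gamma> t)"
  unfolding degree_ideal_def
  by (rule ideal_in_terms) (auto simp: keys_add_monom mdeg_add down_closed_def)

lemma face_ideal_subset_degree_ideal: "face_ideal n \<Gamma> \<subseteq> degree_ideal n \<Gamma> t"
  by (auto simp: face_ideal_def degree_ideal_def)

lemma degree_ideal_mult:
  assumes "down_closed \<Gamma>" "p \<in> degree_ideal n \<Gamma> s" "p' \<in> degree_ideal n \<Gamma> t"
  shows "p * p' \<in> degree_ideal n \<Gamma> (s + t)"
proof -
  have "keys w \<notin> \<Gamma> \<or> s + t \<le> mdeg w" if w: "w \<in> keys (p * p')" for w
  proof -
    obtain v v' where v: "w = v + v'" "v \<in> keys p" "v' \<in> keys p'" using w keys_mult[of p p'] by blast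
    hence "keys v \<notin> \<Gamma> \<or> s \<le> mdeg v" "keys v' \<notin> \<Gamma> \<or> t \<le> mdeg v'"
      using assms(2,3) by (auto simp: degree_ideal_def)
    moreover have "keys v \<in> \<Gamma> \<and> keys v' \<in> \<Gamma>" if "keys w \<in> \<Gamma>"
      using assms(1) that Un_upper1 Un_upper2 unfolding down_closed_def v(1) keys_add_monom by metis
    ultimately show ?thesis by (auto simp: v(1) mdeg_add)
  qed
  thus ?thesis using assms(2,3) polys.mult_closed by (auto simp: degree_ideal_def)
qed

lemma degree_ideal_power:
  assumes "down_closed \<Gamma>" "p \<in> degree_ideal n \<Gamma> 1"
  shows "p ^ t \<in> degree_ideal n \<Gamma> t"
proof (induction t)
  case 0
  show ?case by (simp add: degree_ideal_def polys.one_closed)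
next
  case (Suc t)
  show ?case using degree_ideal_mult[OF assms(1,2) Suc] by simp
qed

lemma mem_ideal_termwise:
  fixes p :: "'k::field mpoly"
  assumes "polys.ideal_in n K" "\<And>w. w \<in> keys p \<Longrightarrow> monom_poly w \<in> K"
  shows "p \<in> K"
proof -
  have "p = (\<Sum>w\<in>keys p. single 0 (lookup p w) * monom_poly w)"
    by (rule poly_mapping_eqI)
      (simp add: monom_poly_def mult_single lookup_sum lookup_single when_def in_keys_iff)
  moreover have "single 0 c \<in> polys n" for c :: 'k by (simp add: mem_polys_iff)
  hence "(\<Sum>w\<in>W. single 0 (lookup p w) * monom_poly w) \<in> K" if "W \<subseteq> keys p" for W
    using that finite_subset[OF that finite_keys]
    by (induction W rule: infinite_finite_induct)
      (simp_all add: polys.ideal_inD[OF assms(1)] assms(2))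
  ultimately show ?thesis by (metis subset_refl)
qed

lemma var_divides:
  assumes "i \<in> keys w"
  obtains w' where "w = var_monom i + w'"
  using set_monom_divides[of "{i}" w] assms that by (auto simp: set_monom_def)

lemma irrelevant_ideal_eq:
  fixes n \<Gamma>
  defines "I \<equiv> face_ideal n \<Gamma> :: 'k::field mpoly set"
  assumes \<Gamma>: "down_closed \<Gamma>"
  shows "irrelevant_ideal n I = ((+>\<^bsub>polynomial_ring n\<^esub>) I) ` degree_ideal n \<Gamma> 1"
proof -
  have I: "polys.ideal_in n I" unfolding I_def by (rule ideal_in_face_ideal[OF \<Gamma>])
  interpret Q: quotient_ring I "polynomial_ring n :: 'k mpoly ring" by (rule quotient_ring_polys[OF I])
  let ?Q = "polynomial_ring n Quot I" and ?X = "(\<lambda>i. Q.proj (monom_poly (var_monom i))) ` {1..n}"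
  have var: "monom_poly (var_monom i) \<in> (polys n :: 'k mpoly set)" if "i \<in> {1..n}" for i
    using that by (intro monom_poly_closed) (simp add: keys_var_monom)
  have sub: "?X \<subseteq> carrier ?Q" using var by (auto simp: Q.carrier_Quot)
  have "Idl\<^bsub>?Q\<^esub> ?X = Q.proj ` degree_ideal n \<Gamma> 1"
  proof
    have "monom_poly (var_monom i) \<in> (degree_ideal n \<Gamma> 1 :: 'k mpoly set)" if "i \<in> {1..n}" for i
      using that by (intro monom_poly_mem_degree_ideal) (simp_all add: keys_var_monom mdeg_var_monom)
    thus "Idl\<^bsub>?Q\<^esub> ?X \<subseteq> Q.proj ` degree_ideal n \<Gamma> 1"
      using ideal_in_degree_ideal[OF \<Gamma>]
      by (intro ring.genideal_minimal[OF Q.quotient_is_ring] Q.ideal_image) (auto simp: ideal_iff)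
    note L = ring.genideal_ideal[OF Q.quotient_is_ring sub]
    have K: "polys.ideal_in n (Q.preimage (Idl\<^bsub>?Q\<^esub> ?X))"
      using Q.ideal_preimage[OF L] by (simp add: ideal_iff)
    have varK: "monom_poly (var_monom i) \<in> Q.preimage (Idl\<^bsub>?Q\<^esub> ?X)" if "i \<in> {1..n}" for i
      using ring.genideal_self[OF Q.quotient_is_ring sub] var that by (auto simp: Q.preimage_def)
    have "p \<in> Q.preimage (Idl\<^bsub>?Q\<^esub> ?X)" if p: "p \<in> degree_ideal n \<Gamma> 1" for p
    proof (rule mem_ideal_termwise[OF K])
      fix w assume w: "w \<in> keys p"
      have wn: "keys w \<subseteq> {1..n}" using p w by (auto simp: degree_ideal_def mem_polys_iff)
      show "monom_poly w \<in> Q.preimage (Idl\<^bsub>?Q\<^esub> ?X)"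
      proof (cases "keys w \<in> \<Gamma>")
        case False
        hence "monom_poly w \<in> I"
          unfolding I_def by (rule monom_poly_mem_face_ideal[OF wn])
        thus ?thesis using Q.subset_preimage[OF L] by blast
      next
        case True
        hence "1 \<le> mdeg w" using p w by (auto simp: degree_ideal_def)
        hence "mdeg w \<noteq> 0" by linarith
          hence "w \<noteq> 0" unfolding mdeg_eq_0_iff .
        then obtain i where i: "i \<in> keys w" by (metis ex_in_conv keys_eq_empty)
        then obtain w' where w': "w = var_monom i + w'" by (rule var_divides)
        hence "monom_poly w' \<in> (polys n :: 'k mpoly set)"
          using wn by (intro monom_poly_closed) (simp add: keys_add_monom)
        moreover have "monom_poly (var_monom i) \<in> Q.preimage (Idl\<^bsub>?Q\<^esub> ?X)" using varK i wn by blast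
        ultimately show ?thesis unfolding w' monom_poly_add by (intro polys.ideal_inD(5)[OF K])
      qed
    qed
    thus "Q.proj ` degree_ideal n \<Gamma> 1 \<subseteq> Idl\<^bsub>?Q\<^esub> ?X" by (auto simp: Q.preimage_def)
  qed
  thus ?thesis by (simp add: irrelevant_ideal_def)
qed

lemma ideal_power_irrelevant:
  fixes n \<Gamma>
  defines "I \<equiv> face_ideal n \<Gamma> :: 'k::field mpoly set"
  assumes \<Gamma>: "down_closed \<Gamma>"
  shows "ideal_power (polynomial_ring n Quot I) (irrelevant_ideal n I) t
    = ((+>\<^bsub>polynomial_ring n\<^esub>) I) ` degree_ideal n \<Gamma> t"
proof -
  have I: "polys.ideal_in n I" unfolding I_def by (rule ideal_in_face_ideal[OF \<Gamma>])
  interpret Q: quotient_ring I "polynomial_ring n :: 'k mpoly ring" by (rule quotient_ring_polys[OF I])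
  let ?Q = "polynomial_ring n Quot I" and ?M = "\<lambda>t. degree_ideal n \<Gamma> t :: 'k mpoly set"
  have M: "ideal (?M t) (polynomial_ring n)" for t
    using ideal_in_degree_ideal[OF \<Gamma>] by (simp add: ideal_iff)
  have Msub: "?M t \<subseteq> polys n" for t by (auto simp: degree_ideal_def)
  have "ideal_power ?Q (Q.proj ` ?M 1) t = Q.proj ` ?M t"
  proof (induction t)
    case 0
    have "?M 0 = polys n" by (auto simp: degree_ideal_def)
    thus ?case by (simp add: Q.carrier_Quot)
  next
    case (Suc t)
    let ?L = "ideal_prod ?Q (Q.proj ` ?M t) (Q.proj ` ?M 1)"
    have L: "ideal ?L ?Q" by (intro ring.ideal_prod_is_ideal[OF Q.quotient_is_ring] Q.ideal_image M)
    have "?L \<subseteq> Q.proj ` ?M (Suc t)"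
    proof
      fix x assume "x \<in> ?L"
      thus "x \<in> Q.proj ` ?M (Suc t)"
      proof induction
        case (prod x y)
        then obtain a b where ab: "a \<in> ?M t" "x = Q.proj a" "b \<in> ?M 1" "y = Q.proj b" by blast
        have "x \<otimes>\<^bsub>?Q\<^esub> y = Q.proj (a * b)"
          using Q.proj_mult[OF subsetD[OF Msub ab(1)] subsetD[OF Msub ab(3)]]
          unfolding ab(2,4) polynomial_ring_ops by (rule sym)
        moreover have "a * b \<in> ?M (Suc t)" using degree_ideal_mult[OF \<Gamma> ab(1,3)] by simp
        ultimately show ?case by blast
      next
        case (sum x y)
        show ?case
          by (rule additive_subgroup.a_closed[OF ideal.axioms(1)[OF Q.ideal_image[OF M]] sum.IH])
      qed
    qed
    moreover have "Q.proj ` ?M (Suc t) \<subseteq> ?L"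
    proof -
      have K: "polys.ideal_in n (Q.preimage ?L)" using Q.ideal_preimage[OF L] by (simp add: ideal_iff)
      have "p \<in> Q.preimage ?L" if p: "p \<in> ?M (Suc t)" for p
      proof (rule mem_ideal_termwise[OF K])
        fix w assume w: "w \<in> keys p"
        have wn: "keys w \<subseteq> {1..n}" using p w by (auto simp: degree_ideal_def mem_polys_iff)
        show "monom_poly w \<in> Q.preimage ?L"
        proof (cases "keys w \<in> \<Gamma>")
          case False
          hence "monom_poly w \<in> I"
            unfolding I_def by (rule monom_poly_mem_face_ideal[OF wn])
          thus ?thesis using Q.subset_preimage[OF L] by blast
        next
          case True
          hence deg: "Suc t \<le> mdeg w" using p w by (auto simp: degree_ideal_def)
          hence "mdeg w \<noteq> 0" by linarith
          hence "w \<noteq> 0" unfolding mdeg_eq_0_iff .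
          then obtain i where i: "i \<in> keys w" by (metis ex_in_conv keys_eq_empty)
          then obtain w' where w': "w = var_monom i + w'" by (rule var_divides)
          have keys: "keys w' \<subseteq> {1..n}" "keys (var_monom i) \<subseteq> {1..n}"
            using wn unfolding w' keys_add_monom by blast+
          have "t \<le> mdeg w'" using deg unfolding w' mdeg_add mdeg_var_monom by simp
          hence "monom_poly w' \<in> ?M t" by (rule monom_poly_mem_degree_ideal[OF keys(1)])
          moreover have "monom_poly (var_monom i) \<in> ?M 1"
            using keys(2) by (rule monom_poly_mem_degree_ideal) (simp add: mdeg_var_monom)
          ultimately have "Q.proj (monom_poly w') \<otimes>\<^bsub>?Q\<^esub> Q.proj (monom_poly (var_monom i)) \<in> ?L"
            by (intro ideal_prod.prod imageI)
          moreover have "Q.proj (monom_poly w') \<otimes>\<^bsub>?Q\<^esub> Q.proj (monom_poly (var_monom i))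
              = Q.proj (monom_poly w)"
            using Q.proj_mult[OF keys[THEN monom_poly_closed]]
            unfolding w' monom_poly_add polynomial_ring_ops by (simp only: mult.commute)
          ultimately show ?thesis using monom_poly_closed[OF wn] unfolding Q.preimage_def by simp
        qed
      qed
      thus ?thesis by (auto simp: Q.preimage_def)
    qed
    ultimately show ?case using Suc by simp
  qed
  thus ?thesis using irrelevant_ideal_eq[OF \<Gamma>, of n, where 'k = 'k] by (simp add: I_def)
qed

section \<open>Dimension\<close>

lemma scalar_unit:
  fixes c :: "'k::field"
  assumes "c \<noteq> 0"
  shows "single 0 c \<in> polys n \<and> (\<exists>d\<in>polys n. d * single 0 c = (1 :: 'k mpoly))"
proof
  show "single 0 c \<in> polys n" by (simp add: mem_polys_iff)
  have "single 0 (inverse c) * single 0 c = (1 :: 'k mpoly)"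
    using assms by (simp add: mult_single)
  thus "\<exists>d\<in>polys n. d * single 0 c = (1 :: 'k mpoly)"
    by (intro bexI[of _ "single 0 (inverse c)"]) (simp_all add: mem_polys_iff)
qed

text \<open>Modulo the prime of the simplex \<open>G\<close> only the variables of \<open>G\<close> survive, so
  \<open>algebraic_relation\<close> applies to polynomials in all variables.\<close>

lemma relation_mod_face:
  fixes fs :: "'k::field mpoly list"
  assumes "G \<subseteq> {1..n}" "card G < length fs" "set fs \<subseteq> polys n"
  obtains A c where "finite A" "A \<noteq> {}" "\<And>as. as \<in> A \<Longrightarrow> length as = length fs"
    "\<And>as. as \<in> A \<Longrightarrow> c as \<noteq> 0"
    "(\<Sum>as\<in>A. single 0 (c as) * list_power fs as) \<in> face_ideal n (Pow G)"
proof -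
  obtain A c where A: "finite A" "A \<noteq> {}" "\<And>as. as \<in> A \<Longrightarrow> length as = length fs"
    "\<And>as. as \<in> A \<Longrightarrow> c as \<noteq> 0"
    "restrict_terms {w. keys w \<subseteq> G} (\<Sum>as\<in>A. single 0 (c as) * list_power fs as) = 0"
    by (rule algebraic_relation[OF finite_vertices[OF assms(1)] assms(2)]) blast
  have "(\<Sum>as\<in>A. single 0 (c as) * list_power fs as) \<in> polys n"
    by (intro polys.sum_closed polys.mult_closed polys.list_power_closed[OF assms(3)])
      (simp add: mem_polys_iff)
  with A show thesis by (intro that[of A c]) (simp_all add: face_ideal_Pow)
qed

text \<open>Choose \<open>f\<^sub>i \<in> P\<^sub>i\<^sub>+\<^sub>1 - P\<^sub>i\<close>. Each \<open>f\<^sub>i\<close> is a nonzerodivisor modulo the prime \<open>P\<^sub>i\<close>. If there were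
  more of them than variables in \<open>G\<close>, a relation among them would descend to \<open>1 \<in> P\<^sub>l\<close>.\<close>

lemma prime_chain_bound:
  fixes P :: "nat \<Rightarrow> 'k::field mpoly set"
  assumes prime: "\<And>i. i \<le> l \<Longrightarrow> primeideal (P i) (polynomial_ring n)"
    and strict: "\<And>i. i < l \<Longrightarrow> P i \<subset> P (Suc i)"
    and G: "G \<subseteq> {1..n}" "face_ideal n (Pow G) \<subseteq> P 0"
  shows "l \<le> card G"
proof (rule ccontr)
  assume "\<not> l \<le> card G"
  have ideal: "polys.ideal_in n (P i)" if "i \<le> l" for i
    using primeideal.axioms(1)[OF prime[OF that]] by (simp add: ideal_iff)
  have "\<exists>f. f \<in> P (Suc i) - P i" if "i < l" for i using strict[OF that] by blast
  then obtain f where f: "\<And>i. i < l \<Longrightarrow> f i \<in> P (Suc i) - P i" by metis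
  let ?fs = "map f [0..<l]"
  have closed: "f i \<in> polys n" if "i < l" for i
    using f[OF that] polys.ideal_inD(1)[OF ideal[of "Suc i"]] that by simp
  have len: "card G < length ?fs" using \<open>\<not> l \<le> card G\<close> by simp
  have closed_fs: "set ?fs \<subseteq> polys n" using closed by auto
  obtain A c where A: "finite A" "A \<noteq> {}" "\<And>as. as \<in> A \<Longrightarrow> length as = length ?fs"
    "\<And>as. as \<in> A \<Longrightarrow> c as \<noteq> 0"
    "(\<Sum>as\<in>A. single 0 (c as) * list_power ?fs as) \<in> face_ideal n (Pow G)"
    by (rule relation_mod_face[OF G(1) len closed_fs]) blast
  have "1 \<in> P (length ?fs)"
  proof (rule polys.relation_descends[where fs = ?fs and A = A and c = "\<lambda>as. single 0 (c as)" and m = 1])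
    fix i assume i: "i < length ?fs"
    hence il: "i < l" by simp
    have "polys.colon n (P i) (f i) \<subseteq> P i"
    proof
      fix a assume "a \<in> polys.colon n (P i) (f i)"
      hence a: "a \<in> polys n" "f i * a \<in> P i" by (simp_all add: polys.colon_def)
      have "f i \<in> P i \<or> a \<in> P i"
        using primeideal.I_prime[OF prime closed[OF il] a(1), of i] a(2) il
        by (simp add: polynomial_ring_ops)
      thus "a \<in> P i" using f[OF il] by simp
    qed
    thus "P i \<subseteq> P (Suc i) \<and> ?fs ! i \<in> P (Suc i) \<and> polys.colon n (P i) (?fs ! i) \<subseteq> P i"
      using f[OF il] strict[OF il] il by auto
  next
    show "single 0 (c as) \<in> polys n \<and> (\<exists>d\<in>polys n. d * single 0 (c as) = 1)" if "as \<in> A" for as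
      by (rule scalar_unit[OF A(4)[OF that]])
    show "(\<Sum>as\<in>A. single 0 (c as) * list_power ?fs as) * 1 \<in> P 0" using A(5) G(2) by auto
  qed (simp_all add: A(1-3) ideal polys.one_closed)
  hence "\<one>\<^bsub>polynomial_ring n\<^esub> \<in> P l" by (simp add: polynomial_ring_ops)
  thus False
    using ideal.one_imp_carrier[OF primeideal.axioms(1)[OF prime]] primeideal.I_notcarr[OF prime]
    by (metis order_refl)
qed

lemma primeideal_face_ideal_Pow:
  "primeideal (face_ideal n (Pow G) :: 'k::field mpoly set) (polynomial_ring n)"
proof (rule primeidealI)
  show "ideal (face_ideal n (Pow G) :: 'k mpoly set) (polynomial_ring n)"
    using ideal_in_face_ideal[OF down_closed_Pow] by (simp add: ideal_iff)
  show "cring (polynomial_ring n :: 'k mpoly ring)" by (rule cring_polynomial_ring)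
  have "1 \<notin> (face_ideal n (Pow G) :: 'k mpoly set)" by (simp add: face_ideal_def)
  thus "carrier (polynomial_ring n) \<noteq> (face_ideal n (Pow G) :: 'k mpoly set)"
    using polys.one_closed by metis
qed (use face_ideal_Pow_prime in \<open>simp add: polynomial_ring_ops\<close>)

text \<open>The vertices whose variables are outside \<open>P\<close> form a face \<open>G\<close>, because the product of these
  variables is outside \<open>P\<close> as well.\<close>

lemma prime_contains_face_prime:
  fixes P :: "'k::field mpoly set"
  assumes P: "primeideal P (polynomial_ring n)" and sub: "face_ideal n \<Gamma> \<subseteq> P"
  obtains G where "G \<in> \<Gamma>" "G \<subseteq> {1..n}" "face_ideal n (Pow G) \<subseteq> P"
proof -
  have I: "polys.ideal_in n P" using primeideal.axioms(1)[OF P] by (simp add: ideal_iff)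
  have one: "1 \<notin> P"
    using ideal.one_imp_carrier[OF primeideal.axioms(1)[OF P]] primeideal.I_notcarr[OF P]
    by (auto simp: polynomial_ring_ops)
  define G where "G = {i \<in> {1..n}. monom_poly (var_monom i) \<notin> P}"
  have G: "G \<subseteq> {1..n}" by (auto simp: G_def)
  have "monom_poly (set_monom H) \<notin> P" if "finite H" "H \<subseteq> G" for H
    using that
  proof (induction H rule: finite_induct)
    case empty
    thus ?case using one by (simp add: set_monom_def monom_poly_def)
  next
    case (insert i H)
    have i: "i \<in> {1..n}" "monom_poly (var_monom i) \<notin> P" and H: "H \<subseteq> {1..n}"
      using insert.prems G by (auto simp: G_def)
    have "monom_poly (set_monom (insert i H)) = monom_poly (var_monom i) * (monom_poly (set_monom H) :: 'k mpoly)"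
      using insert.hyps by (simp add: set_monom_def monom_poly_add)
    moreover have "monom_poly (var_monom i) \<in> (polys n :: 'k mpoly set)"
      using i(1) by (intro monom_poly_closed) (simp add: keys_var_monom)
    ultimately show ?case
      using primeideal.I_prime[OF P _ set_monom_closed[OF H], of "monom_poly (var_monom i)"]
        insert.IH insert.prems i(2) by (auto simp: polynomial_ring_ops)
  qed
  from this[OF finite_vertices[OF G] subset_refl] have "monom_poly (set_monom G) \<notin> P" .
  hence "G \<in> \<Gamma>"
    using sub monom_poly_mem_face_ideal[of "set_monom G" n \<Gamma>] G
    by (auto simp: keys_set_monom finite_vertices)
  moreover have "p \<in> P" if p: "p \<in> face_ideal n (Pow G)" for p
  proof (rule mem_ideal_termwise[OF I])
    fix w assume "w \<in> keys p"
    hence w: "keys w \<subseteq> {1..n}" "\<not> keys w \<subseteq> G" using p by (auto simp: face_ideal_def mem_polys_iff)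
    then obtain i where i: "i \<in> keys w" "i \<notin> G" by blast
    then obtain w' where w': "w = var_monom i + w'" using var_divides by blast
    have "monom_poly (var_monom i) \<in> P" using i w by (auto simp: G_def)
    moreover have "keys w' \<subseteq> {1..n}" using w(1) unfolding w' keys_add_monom by blast
    ultimately show "monom_poly w \<in> P"
      unfolding w' monom_poly_add by (intro polys.ideal_inD(5)[OF I] monom_poly_closed)
  qed
  ultimately show thesis using that G by blast
qed

section \<open>Lengths and the growth of the number of monomials\<close>

text \<open>The residue classes of these monomials form a basis of the polynomial ring modulo
  \<open>degree_ideal n \<Gamma> t\<close>.\<close>

definition face_monoms :: "nat set set \<Rightarrow> nat \<Rightarrow> monom set" where
  "face_monoms \<Gamma> t = {w. keys w \<in> \<Gamma> \<and> mdeg w < t}"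

lemma subspace_ideal:
  assumes "polys.ideal_in n (H :: 'k::field mpoly set)"
  shows "mpoly.subspace H"
  using polys.ideal_inD[OF assms] by (intro mpoly.subspaceI) (simp_all add: mem_polys_iff)

text \<open>Modulo the ideal, every polynomial is congruent to one supported on the finite set of monomials
  outside it. So each step of the chain contributes a new vector in their span, and these vectors
  are linearly independent.\<close>

lemma ideal_chain_length_le:
  assumes fin: "finite (face_monoms \<Gamma> t)"
    and chain: "ideal_chain (polynomial_ring n) (degree_ideal n \<Gamma> t :: 'k::field mpoly set) l"
  shows "l \<le> card (face_monoms \<Gamma> t)"
proof -
  let ?B = "face_monoms \<Gamma> t"
  obtain H where H: "\<And>i. i \<le> l \<Longrightarrow> polys.ideal_in n (H i)"
      "\<And>i. i \<le> l \<Longrightarrow> (degree_ideal n \<Gamma> t :: 'k mpoly set) \<subseteq> H i"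
    and strict: "\<And>i. i < l \<Longrightarrow> H i \<subset> H (Suc i)"
    using chain unfolding ideal_chain_def ideal_iff by metis
  have "\<exists>b. b \<in> H (Suc i) - H i \<and> keys b \<subseteq> ?B" if i: "i < l" for i
  proof -
    obtain p where p: "p \<in> H (Suc i)" "p \<notin> H i" using strict[OF i] by blast
    note HS = H(1)[of "Suc i"]
    have "p \<in> polys n" using p(1) HS i polys.ideal_inD(1) by (metis Suc_leI)
    hence "restrict_terms (- ?B) p \<in> degree_ideal n \<Gamma> t"
      using restrict_terms_closed by (auto simp: degree_ideal_def keys_restrict_terms face_monoms_def)
    hence rest: "restrict_terms (- ?B) p \<in> H i" "restrict_terms (- ?B) p \<in> H (Suc i)"
      using H(2)[of i] H(2)[of "Suc i"] i by auto
    have split: "restrict_terms ?B p = p - restrict_terms (- ?B) p"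
      "p = restrict_terms ?B p + restrict_terms (- ?B) p"
      using restrict_terms_split[of ?B p] by (simp_all add: algebra_simps)
    have "restrict_terms ?B p \<in> H (Suc i)"
      unfolding split(1) using i by (intro polys.ideal_inD(7)[OF HS] p(1) rest(2)) simp
    moreover have "restrict_terms ?B p \<notin> H i"
      using polys.ideal_inD(3)[OF H(1)[of i] _ rest(1), of "restrict_terms ?B p"] p(2) split(2) i
      by auto
    ultimately show ?thesis by (intro exI[of _ "restrict_terms ?B p"]) (simp add: keys_restrict_terms)
  qed
  then obtain b where b: "\<And>i. i < l \<Longrightarrow> b i \<in> H (Suc i) - H i" "\<And>i. i < l \<Longrightarrow> keys (b i) \<subseteq> ?B"
    by metis
  have "j \<le> l \<Longrightarrow> b ` {..<j} \<subseteq> H j \<and> mpoly.independent (b ` {..<j}) \<and> card (b ` {..<j}) = j" for j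
  proof (induction j)
    case (Suc j)
    hence j: "j < l" and IH: "b ` {..<j} \<subseteq> H j" "mpoly.independent (b ` {..<j})" "card (b ` {..<j}) = j"
      by simp_all
    have "mpoly.span (b ` {..<j}) \<subseteq> H j"
      using IH(1) j by (intro mpoly.span_minimal subspace_ideal[OF H(1)]) simp_all
    hence notin: "b j \<notin> mpoly.span (b ` {..<j})" using b(1)[OF j] by blast
    moreover have "b ` {..<Suc j} = insert (b j) (b ` {..<j})" by (auto simp: lessThan_Suc)
    moreover have "b j \<notin> b ` {..<j}" by (rule contrapos_nn[OF notin]) (rule mpoly.span_base)
    moreover have "insert (b j) (b ` {..<j}) \<subseteq> H (Suc j)" using b(1)[OF j] strict[OF j] IH(1) by auto
    ultimately show ?case using IH by (simp add: mpoly.independent_insert)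
  qed (simp add: mpoly.independent_empty)
  from this[of l] have ind: "mpoly.independent (b ` {..<l})" "card (b ` {..<l}) = l" by simp_all
  have "b ` {..<l} \<subseteq> mpoly.span (monom_poly ` ?B)"
  proof
    fix p assume "p \<in> b ` {..<l}"
    hence p: "keys p \<subseteq> ?B" using b(2) by auto
    have "p = (\<Sum>w\<in>keys p. single 0 (lookup p w) * monom_poly w)"
      by (rule poly_mapping_eqI)
        (simp add: monom_poly_def mult_single lookup_sum lookup_single when_def in_keys_iff)
    also have "\<dots> \<in> mpoly.span (monom_poly ` ?B)"
      using p by (intro mpoly.span_sum mpoly.span_scale mpoly.span_base) auto
    finally show "p \<in> mpoly.span (monom_poly ` ?B)" .
  qed
  from mpoly.independent_span_bound[OF finite_imageI[OF fin] ind(1) this]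
  have "l \<le> card (monom_poly ` ?B :: 'k mpoly set)" using ind(2) by simp
  also have "\<dots> \<le> card ?B" by (rule card_image_le[OF fin])
  finally show ?thesis .
qed

lemma le_add_monom: "w \<le> v + (w :: monom)"
  by (rule leI) (auto simp: less_monom_iff lookup_add)

text \<open>Adding the monomials one at a time, from the largest to the smallest in the lexicographic
  order, gives ideals at every step because multiplication does not decrease monomials.\<close>

lemma ideal_chain_length_ge:
  assumes \<Gamma>: "down_closed \<Gamma>" "\<Gamma> \<subseteq> Pow {1..n}" and fin: "finite (face_monoms \<Gamma> t)"
  shows "ideal_chain (polynomial_ring n) (degree_ideal n \<Gamma> t :: 'k::field mpoly set)
    (card (face_monoms \<Gamma> t))"
proof -
  let ?B = "face_monoms \<Gamma> t"
  \<comment> \<open>the position of \<open>w\<close> in the list of these monomials from the largest to the smallest\<close>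
  define rank where "rank w = card {w' \<in> ?B. w < w'}" for w
  define H where "H i = {p :: 'k mpoly. p \<in> polys n \<and> keys p \<subseteq> {w. w \<in> ?B \<longrightarrow> rank w < i}}" for i
  have mono: "rank (v + w) \<le> rank w" for v w
    unfolding rank_def using fin le_add_monom[of w v] by (intro card_mono) auto
  have down: "w \<in> ?B" if "v + w \<in> ?B" for v w
    using that \<Gamma>(1) by (auto simp: face_monoms_def keys_add_monom mdeg_add down_closed_def)
  have "polys.ideal_in n (H i)" for i
    unfolding H_def
  proof (rule ideal_in_terms)
    fix v w assume "w \<in> {w. w \<in> ?B \<longrightarrow> rank w < i}"
    thus "v + w \<in> {w. w \<in> ?B \<longrightarrow> rank w < i}" using down[of v w] mono[of v w] by auto
  qed
  moreover have "degree_ideal n \<Gamma> t \<subseteq> H i" for i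
    by (auto simp: degree_ideal_def H_def face_monoms_def)
  moreover have "H i \<subset> H (Suc i)" if i: "i < card ?B" for i
  proof -
    have less: "rank w' < rank w" if "w \<in> ?B" "w' \<in> ?B" "w < w'" for w w'
      unfolding rank_def using fin that by (intro psubset_card_mono) auto
    have "inj_on rank ?B"
      by (rule inj_onI) (metis less less_irrefl linorder_neqE)
    hence "card (rank ` ?B) = card ?B" by (rule card_image)
    moreover have "rank w < card ?B" if "w \<in> ?B" for w
      unfolding rank_def using fin that by (intro psubset_card_mono) auto
    hence "rank ` ?B \<subseteq> {..<card ?B}" by auto
    ultimately have "rank ` ?B = {..<card ?B}" by (intro card_subset_eq) auto
    then obtain w where w: "w \<in> ?B" "rank w = i" using i by (metis imageE lessThan_iff)
    have "keys w \<subseteq> {1..n}" using w(1) \<Gamma>(2) by (auto simp: face_monoms_def)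
    hence "monom_poly w \<in> H (Suc i)" "monom_poly w \<notin> H i"
      using w by (simp_all add: H_def keys_monom_poly monom_poly_closed)
    moreover have "H i \<subseteq> H (Suc i)" by (auto simp: H_def)
    ultimately show ?thesis by blast
  qed
  ultimately show ?thesis
    unfolding ideal_chain_def ideal_iff by (intro exI[of _ H]) simp
qed

text \<open>Splitting off the exponent of one variable, which is positive, leads to the sum of the numbers
  \<open>r\<close> choose \<open>k\<close> over all \<open>r < s\<close>, which is \<open>s\<close> choose \<open>k + 1\<close>.\<close>

lemma card_monoms_with_support:
  assumes "finite G"
  shows "finite {w :: monom. keys w = G \<and> mdeg w \<le> s} \<and> card {w. keys w = G \<and> mdeg w \<le> s} = s choose card G"
  using assms
proof (induction G arbitrary: s rule: finite_induct)
  case empty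
  have "{w :: monom. keys w = {} \<and> mdeg w \<le> s} = {0}" by (auto simp: mdeg_def)
  thus ?case by simp
next
  case (insert v G)
  let ?N = "\<lambda>G s. {w :: monom. keys w = G \<and> mdeg w \<le> s}"
  let ?S = "SIGMA a:{..<s}. ?N G (s - Suc a)"
  let ?f = "\<lambda>(a, w). single v (Suc a) + w"
  have inj: "inj_on ?f ?S"
  proof (rule inj_onI)
    fix x y assume xy: "x \<in> ?S" "y \<in> ?S" "?f x = ?f y"
    obtain a w b w' where eq: "x = (a, w)" "y = (b, w')" by (metis surj_pair)
    have "v \<notin> keys w" "v \<notin> keys w'" using insert.hyps xy(1,2) by (simp_all add: eq)
    hence zero: "lookup w v = 0" "lookup w' v = 0" by (simp_all add: in_keys_iff)
    have sum: "single v (Suc a) + w = single v (Suc b) + w'" using xy(3) by (simp add: eq)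
    from arg_cong[OF this, of "\<lambda>w. lookup w v"] have "a = b" by (simp add: lookup_add zero)
    thus "x = y" using sum by (simp add: eq)
  qed
  have image: "?f ` ?S = ?N (insert v G) s"
  proof (intro equalityI subsetI)
    fix w assume "w \<in> ?N (insert v G) s"
    hence w: "keys w = insert v G" "mdeg w \<le> s" by auto
    define w' where "w' = w - single v (lookup w v)"
    have eq: "w = single v (lookup w v) + w'"
      by (rule poly_mapping_eqI) (simp add: w'_def lookup_add lookup_minus lookup_single when_def)
    have pos: "0 < lookup w v" using w by (auto simp: in_keys_iff)
    have "lookup w' i = (if i = v then 0 else lookup w i)" for i
      by (simp add: w'_def lookup_minus lookup_single when_def)
    hence "keys w' = keys w - {v}" by (auto simp: in_keys_iff split: if_splits)
    hence keys: "keys w' = G" using w insert.hyps by auto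
    have "mdeg w = lookup w v + mdeg w'"
      by (subst eq) (simp add: mdeg_add mdeg_def[of "single _ _"] pos)
    hence "(lookup w v - 1, w') \<in> ?S" using w pos keys by auto
    moreover have "w = ?f (lookup w v - 1, w')" using eq pos by simp
    ultimately show "w \<in> ?f ` ?S" by blast
  qed (auto simp: keys_add_monom mdeg_add mdeg_def[of "single _ _"])
  have "finite ?S" using insert.IH by blast
  hence "finite (?N (insert v G) s)" unfolding image[symmetric] by (rule finite_imageI)
  moreover have "card ?S = s choose Suc (card G)"
  proof -
    have "card ?S = (\<Sum>a<s. (s - Suc a) choose card G)" using insert.IH by simp
      also have "\<dots> = (\<Sum>r<s. r choose card G)" by (rule sum.nat_diff_reindex)
    also have "\<dots> = s choose Suc (card G)" by (induction s) simp_all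
    finally show ?thesis .
  qed
  ultimately show ?case using card_image[OF inj] insert.hyps unfolding image by simp
qed

lemma card_face_monoms:
  assumes "finite \<Gamma>" "\<And>G. G \<in> \<Gamma> \<Longrightarrow> finite G"
  shows "finite (face_monoms \<Gamma> t)" "card (face_monoms \<Gamma> (Suc s)) = (\<Sum>G\<in>\<Gamma>. s choose card G)"
proof -
  have eq: "face_monoms \<Gamma> (Suc s) = (\<Union>G\<in>\<Gamma>. {w. keys w = G \<and> mdeg w \<le> s})" for s
    by (auto simp: face_monoms_def)
  have fin: "finite (face_monoms \<Gamma> (Suc s))" for s
    unfolding eq using assms card_monoms_with_support by simp
  show "finite (face_monoms \<Gamma> t)"
    by (rule finite_subset[OF _ fin[of t]]) (auto simp: face_monoms_def)
  show "card (face_monoms \<Gamma> (Suc s)) = (\<Sum>G\<in>\<Gamma>. s choose card G)"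
    unfolding eq using assms card_monoms_with_support by (subst card_UN_disjoint) auto
qed

lemma binomial_asymptotics:
  "(\<lambda>t. real ((t - 1) choose k) / real t ^ k) \<longlonglongrightarrow> 1 / fact k"
proof -
  have "(\<lambda>t. real (t - 1) / real t - real i / real t) \<longlonglongrightarrow> 1" for i
  proof -
    have "(\<lambda>t. 1 - real (Suc i) / real t) \<longlonglongrightarrow> 1 - 0"
      by (intro tendsto_diff tendsto_const lim_const_over_n)
    hence "(\<lambda>t. 1 - real (Suc i) / real t) \<longlonglongrightarrow> 1" by simp
    moreover have "\<forall>\<^sub>F t in sequentially. 1 - real (Suc i) / real t = real (t - 1) / real t - real i / real t"
      using eventually_gt_at_top[of "0 :: nat"] by eventually_elim (simp add: field_simps of_nat_diff)
    ultimately show ?thesis by (rule Lim_transform_eventually)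
  qed
  hence "(\<lambda>t. (\<Prod>i=0..<k. real (t - 1) / real t - real i / real t) / fact k) \<longlonglongrightarrow> (\<Prod>i=0..<k. 1) / fact k"
    by (intro tendsto_divide tendsto_prod tendsto_const) simp_all
  moreover have "real ((t - 1) choose k) / real t ^ k
      = (\<Prod>i=0..<k. real (t - 1) / real t - real i / real t) / fact k" for t
    unfolding binomial_gbinomial gbinomial_prod_rev
    by (simp add: prod_dividef flip: diff_divide_distrib)
  ultimately show ?thesis by simp
qed

text \<open>A face with \<open>k\<close> vertices contributes a polynomial of degree \<open>k\<close> in \<open>t\<close> with leading coefficient
  \<open>1/k!\<close>, so only the faces with \<open>q\<close> vertices survive in the limit.\<close>

lemma face_monoms_asymptotics:
  assumes "finite \<Gamma>" "\<And>G. G \<in> \<Gamma> \<Longrightarrow> finite G \<and> card G \<le> q"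
  shows "(\<lambda>t. fact q * real (card (face_monoms \<Gamma> t)) / real t ^ q) \<longlonglongrightarrow> real (card {G \<in> \<Gamma>. card G = q})"
proof -
  have single: "(\<lambda>t. fact q * (real ((t - 1) choose k) / real t ^ q)) \<longlonglongrightarrow> (if k = q then 1 else 0)"
    if "k \<le> q" for k
  proof -
    have "(\<lambda>t. fact q * (real ((t - 1) choose k) / real t ^ k * (1 / real t) ^ (q - k)))
        \<longlonglongrightarrow> fact q * (1 / fact k * 0 ^ (q - k))"
      by (intro tendsto_mult tendsto_const binomial_asymptotics tendsto_power lim_const_over_n)
    moreover have "real ((t - 1) choose k) / real t ^ q
        = real ((t - 1) choose k) / real t ^ k * (1 / real t) ^ (q - k)" for t
    proof -
      have "real t ^ q = real t ^ k * real t ^ (q - k)"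
        using that by (simp flip: power_add)
      thus ?thesis by (simp add: power_divide)
    qed
    moreover have "fact q * (1 / fact k * 0 ^ (q - k)) = (if k = q then 1 else 0 :: real)"
      using that by (simp add: zero_power)
    ultimately show ?thesis by simp
  qed
  have "(\<lambda>t. \<Sum>G\<in>\<Gamma>. fact q * (real ((t - 1) choose card G) / real t ^ q))
      \<longlonglongrightarrow> (\<Sum>G\<in>\<Gamma>. if card G = q then 1 else 0)"
    using assms(2) by (intro tendsto_sum single) simp
  also have "(\<Sum>G\<in>\<Gamma>. if card G = q then 1 else 0) = real (card {G \<in> \<Gamma>. card G = q})"
    using assms(1) by (simp flip: sum.inter_filter)
  finally have "(\<lambda>t. \<Sum>G\<in>\<Gamma>. fact q * (real ((t - 1) choose card G) / real t ^ q))
      \<longlonglongrightarrow> real (card {G \<in> \<Gamma>. card G = q})" .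
  moreover have "\<forall>\<^sub>F t in sequentially.
      (\<Sum>G\<in>\<Gamma>. fact q * (real ((t - 1) choose card G) / real t ^ q))
      = fact q * real (card (face_monoms \<Gamma> t)) / real t ^ q"
    using eventually_gt_at_top[of "0 :: nat"]
  proof eventually_elim
    case (elim t)
    have "card (face_monoms \<Gamma> t) = (\<Sum>G\<in>\<Gamma>. (t - 1) choose card G)"
      using card_face_monoms(2)[OF assms(1), of "t - 1"] assms(2) elim by simp
    thus ?case by (simp add: sum_distrib_left sum_divide_distrib)
  qed
  ultimately show ?thesis by (rule Lim_transform_eventually)
qed

section \<open>The complex of a final squarefree lexsegment ideal\<close>

lemma set_monom_less_iff:
  assumes "finite A" "finite B"
  shows "set_monom A < set_monom B \<longleftrightarrow> (\<exists>j. j \<in> B \<and> j \<notin> A \<and> (\<forall>k<j. k \<in> A \<longleftrightarrow> k \<in> B))"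
proof -
  have "(lookup (set_monom A) j < lookup (set_monom B) j) = (j \<in> B \<and> j \<notin> A)"
    "(lookup (set_monom A) j = lookup (set_monom B) j) = (j \<in> A \<longleftrightarrow> j \<in> B)" for j
    by (simp_all add: lookup_set_monom assms)
  thus ?thesis unfolding less_monom_iff by simp
qed

locale final_lexsegment_complex =
  fixes n q :: nat and U :: "nat set"
  assumes U_subset: "U \<subseteq> {1..n}" and one_in_U: "1 \<in> U" and card_U: "card U = q"
    and U_not_initial: "U \<noteq> {1..q}"
begin

text \<open>A set is a nonface exactly if it contains the support of one of the generating monomials.\<close>

definition faces :: "nat set set" where
  "faces = {G. G \<subseteq> {1..n} \<and> (\<forall>H\<subseteq>G. card H = q \<longrightarrow> set_monom U < set_monom H)}"

lemma finite_U: "finite U"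
  using U_subset by (rule finite_vertices)

lemma q_pos: "0 < q"
  using card_U finite_U one_in_U by (auto simp: card_gt_0_iff)

lemma q_le_n: "q \<le> n"
  using card_mono[OF _ U_subset] card_U by simp

lemma faces_subset: "faces \<subseteq> Pow {1..n}"
  by (auto simp: faces_def)

lemma down_closed_faces: "down_closed faces"
  unfolding down_closed_def faces_def by blast

lemma less_without_one:
  assumes "H \<subseteq> {1..n}" "1 \<notin> H"
  shows "\<not> set_monom U < set_monom H"
proof
  assume "set_monom U < set_monom H"
  then obtain j where j: "j \<in> H" "j \<notin> U" "\<forall>k<j. k \<in> U \<longleftrightarrow> k \<in> H"
    using set_monom_less_iff[OF finite_U finite_vertices[OF assms(1)]] by auto
  have "\<not> 1 < j" using j(3) assms(2) one_in_U by blast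
  moreover have "j \<noteq> 0" "j \<noteq> 1" using j assms by auto
  ultimately show False by simp
qed

lemma small_sets_are_faces:
  assumes "G \<subseteq> {1..n}" "card G < q"
  shows "G \<in> faces"
proof -
  have "card H \<noteq> q" if "H \<subseteq> G" for H
    using card_mono[OF finite_vertices[OF assms(1)] that] assms(2) by simp
  thus ?thesis using assms(1) by (simp add: faces_def)
qed

text \<open>A set with more than \<open>q\<close> elements has a \<open>q\<close>-element subset that avoids \<open>1\<close>.\<close>

lemma card_face_le:
  assumes "G \<in> faces"
  shows "card G \<le> q"
proof (rule ccontr)
  assume "\<not> card G \<le> q"
  have G: "G \<subseteq> {1..n}" using assms faces_subset by auto
  have "q \<le> card (G - {1})"
    using \<open>\<not> card G \<le> q\<close> card_Diff_singleton_if[of G 1] by (auto split: if_splits)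
  then obtain H where H: "H \<subseteq> G - {1}" "card H = q" by (metis obtain_subset_with_card_n)
  hence "set_monom U < set_monom H" using assms by (auto simp: faces_def)
  thus False using less_without_one[of H] H G by blast
qed

lemma card_q_face_iff:
  assumes "card G = q"
  shows "G \<in> faces \<longleftrightarrow> G \<subseteq> {1..n} \<and> set_monom U < set_monom G"
proof -
  have "H = G" if "G \<subseteq> {1..n}" "H \<subseteq> G" "card H = q" for H
    using card_subset_eq[OF finite_vertices[OF that(1)] that(2)] assms that(3) by simp
  thus ?thesis using assms unfolding faces_def by blast
qed

text \<open>The smallest element of \<open>{1..q}\<close> that is missing in \<open>U\<close> decides the comparison.\<close>

lemma initial_segment_face: "{1..q} \<in> faces"
proof -
  have "\<not> {1..q} \<subseteq> U"
    using card_subset_eq[OF finite_U, of "{1..q}"] card_U U_not_initial by auto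
  then obtain j0 where "j0 \<in> {1..q} \<and> j0 \<notin> U" by blast
  define j where "j = (LEAST j. j \<in> {1..q} \<and> j \<notin> U)"
  have j: "j \<in> {1..q}" "j \<notin> U"
    using LeastI[of "\<lambda>j. j \<in> {1..q} \<and> j \<notin> U", OF \<open>j0 \<in> {1..q} \<and> j0 \<notin> U\<close>] by (simp_all add: j_def)
  have "k \<in> U \<longleftrightarrow> k \<in> {1..q}" if "k < j" for k
  proof (cases "k = 0")
    case True
    thus ?thesis using U_subset by auto
  next
    case False
    hence "k \<in> {1..q}" using that j by simp
    thus ?thesis using not_less_Least[of k "\<lambda>j. j \<in> {1..q} \<and> j \<notin> U"] that by (auto simp: j_def)
  qed
  hence "set_monom U < set_monom {1..q}"
    unfolding set_monom_less_iff[OF finite_U finite_atLeastAtMost] using j by blast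
  thus ?thesis using card_q_face_iff[of "{1..q}"] q_le_n by simp
qed

text \<open>A \<open>q\<close>-element set that contains \<open>U - {1}\<close> is \<open>U\<close> itself or avoids \<open>1\<close>, so it is not larger
  than \<open>U\<close>. Hence \<open>U - {1}\<close>, with \<open>q - 1\<close> elements, is a facet, and this keeps the depth below the
  dimension.\<close>

lemma small_facet:
  assumes "G \<subseteq> {1..n}" "U - {1} \<subset> G"
  shows "G \<notin> faces"
proof -
  obtain j where j: "j \<in> G" "j \<notin> U - {1}" using assms(2) by blast
  let ?H = "insert j (U - {1})"
  have "card ?H = q"
    using j(2) finite_U one_in_U card_U q_pos by (simp add: card_insert_if)
  moreover have "?H \<subseteq> G" using j assms by blast
  moreover have "\<not> set_monom U < set_monom ?H"
  proof (cases "j = 1")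
    case True
    hence "?H = U" using one_in_U by blast
    thus ?thesis by simp
  next
    case False
    have "?H \<subseteq> {1..n}" using j(1) assms(1) U_subset by blast
    thus ?thesis using less_without_one[of ?H] False by blast
  qed
  ultimately show ?thesis unfolding faces_def by blast
qed

lemma squarefree_monoms_eq: "squarefree_monoms n q = set_monom ` {H. H \<subseteq> {1..n} \<and> card H = q}"
proof (intro equalityI subsetI)
  fix w assume "w \<in> squarefree_monoms n q"
  hence w: "keys w \<subseteq> {1..n}" "\<And>i. lookup w i \<le> 1" "(\<Sum>i\<in>{1..n}. lookup w i) = q"
    by (auto simp: squarefree_monoms_def)
  have "lookup w i = (if i \<in> keys w then 1 else 0)" for i
    using w(2)[of i] by (auto simp: in_keys_iff)
  hence eq: "w = set_monom (keys w)"
    by (intro poly_mapping_eqI) (simp add: lookup_set_monom)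
  have "card (keys w) = mdeg w" by (subst (2) eq) (simp add: mdeg_set_monom)
  also have "\<dots> = q" using mdeg_superset[OF _ w(1)] w(3) by simp
  finally show "w \<in> set_monom ` {H. H \<subseteq> {1..n} \<and> card H = q}" using eq w(1) by blast
next
  fix w assume "w \<in> set_monom ` {H. H \<subseteq> {1..n} \<and> card H = q}"
  then obtain H where H: "w = set_monom H" "H \<subseteq> {1..n}" "card H = q" by blast
  note fin = finite_vertices[OF H(2)]
  have "(\<Sum>i\<in>{1..n}. lookup w i) = q"
    using mdeg_superset[of "{1..n}" w] mdeg_set_monom[OF fin] H by (simp add: keys_set_monom[OF fin])
  thus "w \<in> squarefree_monoms n q"
    using H by (simp add: squarefree_monoms_def keys_set_monom[OF fin] lookup_set_monom[OF fin])
qed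

lemma lexsegment_ideal_eq:
  "Idl\<^bsub>polynomial_ring n\<^esub> (monom_poly ` final_lexsegment n q (set_monom U))
    = (face_ideal n faces :: 'k::field mpoly set)"
proof -
  interpret R: cring "polynomial_ring n :: 'k mpoly ring" by (rule cring_polynomial_ring)
  let ?G = "monom_poly ` final_lexsegment n q (set_monom U) :: 'k mpoly set"
  have gens: "?G = (\<lambda>H. monom_poly (set_monom H)) `
      {H. H \<subseteq> {1..n} \<and> card H = q \<and> set_monom H \<le> set_monom U}"
    by (auto simp: final_lexsegment_def squarefree_monoms_eq)
  have sub: "?G \<subseteq> polys n" unfolding gens using set_monom_closed by blast
  have K: "polys.ideal_in n (Idl\<^bsub>polynomial_ring n\<^esub> ?G)"
    using R.genideal_ideal[OF sub] by (simp add: ideal_iff)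
  show ?thesis
  proof
    have "?G \<subseteq> face_ideal n faces"
    proof
      fix p assume "p \<in> ?G"
      then obtain H where H: "p = monom_poly (set_monom H)" "H \<subseteq> {1..n}" "card H = q"
        "set_monom H \<le> set_monom U" unfolding gens by blast
      have "H \<notin> faces" using card_q_face_iff[OF H(3)] H(4) by (simp add: not_less)
      thus "p \<in> face_ideal n faces"
        unfolding H(1) using H(2) by (intro monom_poly_mem_face_ideal)
          (simp_all add: keys_set_monom finite_vertices)
    qed
    thus "Idl\<^bsub>polynomial_ring n\<^esub> ?G \<subseteq> face_ideal n faces"
      using ideal_in_face_ideal[OF down_closed_faces]
      by (intro R.genideal_minimal) (simp_all add: ideal_iff)
    show "face_ideal n faces \<subseteq> Idl\<^bsub>polynomial_ring n\<^esub> ?G"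
    proof
      fix p :: "'k mpoly" assume p: "p \<in> face_ideal n faces"
      show "p \<in> Idl\<^bsub>polynomial_ring n\<^esub> ?G"
      proof (rule mem_ideal_termwise[OF K])
        fix w assume "w \<in> keys p"
        hence w: "keys w \<subseteq> {1..n}" "keys w \<notin> faces" using p by (auto simp: face_ideal_def mem_polys_iff)
        then obtain H where H: "H \<subseteq> keys w" "card H = q" "\<not> set_monom U < set_monom H"
          by (auto simp: faces_def)
        have Hn: "H \<subseteq> {1..n}" using H(1) w(1) by (rule subset_trans)
        have "monom_poly (set_monom H) \<in> ?G" unfolding gens using H Hn by (auto simp: not_less)
        hence gen: "monom_poly (set_monom H) \<in> Idl\<^bsub>polynomial_ring n\<^esub> ?G"
          using R.genideal_self[OF sub] by blast
        define w' where "w' = w - set_monom H"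
        have eq: "w = set_monom H + w'"
          unfolding w'_def by (rule set_monom_divides[OF finite_vertices[OF Hn] H(1)])
        have "keys w' \<subseteq> {1..n}" using w(1) eq keys_add_monom[of "set_monom H" w'] by simp
        thus "monom_poly w \<in> Idl\<^bsub>polynomial_ring n\<^esub> ?G"
          unfolding eq monom_poly_add by (intro polys.ideal_inD(5)[OF K] monom_poly_closed gen)
      qed
    qed
  qed
qed

text \<open>Complementation reverses the lexicographic order on squarefree monomials.\<close>

lemma set_monom_complement_less_iff:
  assumes "G \<subseteq> {1..n}"
  shows "set_monom G < set_monom ({1..n} - U) \<longleftrightarrow> set_monom U < set_monom ({1..n} - G)"
proof -
  have "(j \<in> {1..n} - U \<and> j \<notin> G \<and> (\<forall>k<j. k \<in> G \<longleftrightarrow> k \<in> {1..n} - U))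
      \<longleftrightarrow> (j \<in> {1..n} - G \<and> j \<notin> U \<and> (\<forall>k<j. k \<in> U \<longleftrightarrow> k \<in> {1..n} - G))" for j
    using assms U_subset by blast
  thus ?thesis
    using finite_vertices[OF assms] finite_U by (simp add: set_monom_less_iff)
qed

lemma card_large_facets:
  "card {set_monom G | G. G \<subseteq> {1..n} \<and> card G = n - q \<and> set_monom G < set_monom ({1..n} - U)}
    = card {G \<in> faces. card G = q}"
proof -
  let ?f = "\<lambda>H. set_monom ({1..n} - H)"
  have image: "?f ` {G \<in> faces. card G = q}
      = {set_monom G | G. G \<subseteq> {1..n} \<and> card G = n - q \<and> set_monom G < set_monom ({1..n} - U)}"
  proof (intro equalityI subsetI)
    fix w assume "w \<in> ?f ` {G \<in> faces. card G = q}"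
    then obtain H where H: "H \<in> faces" "card H = q" "w = ?f H" by blast
    have "H \<subseteq> {1..n}" "set_monom U < set_monom H" using card_q_face_iff[OF H(2)] H(1) by simp_all
    moreover have "{1..n} - ({1..n} - H) = H" using calculation(1) by blast
    moreover have "card ({1..n} - H) = n - q"
      using calculation(1) H(2) finite_vertices by (simp add: card_Diff_subset)
    ultimately show "w \<in> {set_monom G | G. G \<subseteq> {1..n} \<and> card G = n - q
        \<and> set_monom G < set_monom ({1..n} - U)}"
      using set_monom_complement_less_iff[of "{1..n} - H"] H(3) by auto
  next
    fix w assume "w \<in> {set_monom G | G. G \<subseteq> {1..n} \<and> card G = n - q
        \<and> set_monom G < set_monom ({1..n} - U)}"
    then obtain G where G: "w = set_monom G" "G \<subseteq> {1..n}" "card G = n - q"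
      "set_monom G < set_monom ({1..n} - U)" by blast
    have card: "card ({1..n} - G) = q"
      using G(2,3) q_le_n finite_vertices by (simp add: card_Diff_subset)
    moreover have "{1..n} - G \<in> faces"
      using card_q_face_iff[OF card] set_monom_complement_less_iff[OF G(2)] G(4) by simp
    moreover have "{1..n} - ({1..n} - G) = G" using G(2) by blast
    ultimately show "w \<in> ?f ` {G \<in> faces. card G = q}" using G(1) by (metis (mono_tags) imageI mem_Collect_eq)
  qed
  have inj: "inj_on ?f {G \<in> faces. card G = q}"
  proof (rule inj_onI)
    fix G H assume GH: "G \<in> {G \<in> faces. card G = q}" "H \<in> {G \<in> faces. card G = q}" "?f G = ?f H"
    have "keys (?f G) = keys (?f H)" using GH(3) by simp
    hence "{1..n} - G = {1..n} - H" by (simp add: keys_set_monom)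
    moreover have "G \<subseteq> {1..n}" "H \<subseteq> {1..n}" using GH(1,2) faces_subset by auto
    ultimately show "G = H" by blast
  qed
  show ?thesis unfolding image[symmetric] by (rule card_image[OF inj])
qed

section \<open>Dimension, depth and multiplicity\<close>

lemma ideal_in_faces: "polys.ideal_in n (face_ideal n faces)"
  by (rule ideal_in_face_ideal[OF down_closed_faces])

text \<open>The primes of the simplices \<open>{1..q}, {1..q - 1}, \<dots>, {}\<close> form a chain of length \<open>q\<close>.
  Conversely, the smallest member of a chain of primes contains the prime of a face.\<close>

lemma krull_dim_lexsegment:
  "krull_dim (polynomial_ring n Quot (face_ideal n faces :: 'k::field mpoly set)) = enat q"
  unfolding krull_dim_def
proof (rule Sup_enat_eqI)
  let ?I = "face_ideal n faces :: 'k mpoly set"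
  interpret Q: quotient_ring ?I "polynomial_ring n :: 'k mpoly ring"
    by (rule quotient_ring_polys[OF ideal_in_faces])
  {
    define P where "P i = (face_ideal n (Pow {1..q - i}) :: 'k mpoly set)" for i
    have face: "{1..q - i} \<in> faces" for i
      using initial_segment_face down_closed_faces by (auto simp: down_closed_def)
    have sub: "?I \<subseteq> P i" for i
      using face[of i] down_closed_faces unfolding P_def face_ideal_def down_closed_def by blast
    have ideal: "ideal (P i) (polynomial_ring n)" for i
      unfolding P_def using ideal_in_face_ideal[OF down_closed_Pow] by (simp add: ideal_iff)
    have "Q.proj ` P i \<subset> Q.proj ` P (Suc i)" if i: "i < q" for i
    proof (rule Q.image_strict_mono[OF ideal ideal sub sub])
      have "{1..q - Suc i} = {1..q - i} - {q - i}" using i by auto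
      moreover have "q - i \<in> {1..q - i}" "q - i \<in> {1..n}" using i q_le_n by auto
      ultimately show "P i \<subset> P (Suc i)" unfolding P_def by (metis face_ideal_Pow_strict)
    qed
    moreover have "primeideal (Q.proj ` P i) (polynomial_ring n Quot ?I)" for i
      using Q.primeideal_image[OF _ sub] primeideal_face_ideal_Pow unfolding P_def by blast
    ultimately show "\<exists>P. (\<forall>i\<le>q. primeideal (P i) (polynomial_ring n Quot ?I)) \<and> (\<forall>i<q. P i \<subset> P (Suc i))"
      by (intro exI[of _ "\<lambda>i. Q.proj ` P i"]) simp
  next
    fix l assume "\<exists>P. (\<forall>i\<le>l. primeideal (P i) (polynomial_ring n Quot ?I)) \<and> (\<forall>i<l. P i \<subset> P (Suc i))"
    then obtain P where P: "\<And>i. i \<le> l \<Longrightarrow> primeideal (P i) (polynomial_ring n Quot ?I)"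
      "\<And>i. i < l \<Longrightarrow> P i \<subset> P (Suc i)" by blast
    have prime: "primeideal (Q.preimage (P i)) (polynomial_ring n)" if "i \<le> l" for i
      using Q.primeideal_preimage[OF P(1)[OF that]] .
    have strict: "Q.preimage (P i) \<subset> Q.preimage (P (Suc i))" if "i < l" for i
      using P(1)[of i] P(1)[of "Suc i"] that
      by (intro Q.preimage_strict_mono P(2)) (simp_all add: primeideal.axioms(1))
    have "?I \<subseteq> Q.preimage (P 0)"
      by (rule Q.subset_preimage[OF primeideal.axioms(1)[OF P(1)]]) simp
    then obtain G where G: "G \<in> faces" "G \<subseteq> {1..n}" "face_ideal n (Pow G) \<subseteq> Q.preimage (P 0)"
      by (rule prime_contains_face_prime[OF prime[OF le0]])
    have "l \<le> card G" by (rule prime_chain_bound[OF prime strict G(2,3)])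
    thus "l \<le> q" using card_face_le[OF G(1)] by simp
  }
qed

text \<open>The monomial \<open>x\<^sub>F\<close> of the small facet \<open>F\<close> is annihilated by the prime of \<open>F\<close>. So a relation
  among \<open>q\<close> elements in the \<open>q - 1\<close> variables of \<open>F\<close> kills \<open>x\<^sub>F\<close>, and if the elements form a
  regular sequence, \<open>x\<^sub>F\<close> lies in the ideal that they generate. This also applies to their \<open>q\<close>-th
  powers, but \<open>x\<^sub>F\<close> has degree \<open>q - 1\<close>.\<close>

lemma weakly_regular_length_less:
  fixes gs :: "'k::field mpoly list"
  assumes gs: "set gs \<subseteq> degree_ideal n faces 1"
    and reg: "polys.weakly_regular n (face_ideal n faces) gs"
  shows "length gs < q"
proof (rule ccontr)
  assume "\<not> length gs < q"
  let ?I = "face_ideal n faces :: 'k mpoly set" and ?F = "U - {1}"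
  let ?x = "monom_poly (set_monom ?F) :: 'k mpoly"
  \<comment> \<open>the exponent exceeds the degree of \<open>x\<^sub>F\<close>\<close>
  define hs where "hs = map (\<lambda>g. g ^ q) gs"
  have gs_closed: "set gs \<subseteq> polys n" using gs by (auto simp: degree_ideal_def)
  have hs_closed: "set hs \<subseteq> polys n"
    using gs_closed polys.power_closed by (auto simp: hs_def)
  have hs_reg: "polys.weakly_regular n ?I hs"
    unfolding hs_def by (rule polys.weakly_regular_powers[OF ideal_in_faces gs_closed reg])
  have F: "?F \<subseteq> {1..n}" "card ?F = q - 1"
    using U_subset card_U finite_U one_in_U by auto
  have "card ?F < length hs" using F(2) q_pos \<open>\<not> length gs < q\<close> by (simp add: hs_def)
  then obtain A c where A: "finite A" "A \<noteq> {}" "\<And>as. as \<in> A \<Longrightarrow> length as = length hs"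
    "\<And>as. as \<in> A \<Longrightarrow> c as \<noteq> 0"
    "(\<Sum>as\<in>A. single 0 (c as) * list_power hs as) \<in> face_ideal n (Pow ?F)"
    by (rule relation_mod_face[OF F(1) _ hs_closed]) blast
  have x_closed: "?x \<in> polys n" by (rule set_monom_closed[OF F(1)])
  have "z * ?x \<in> ?I" if z: "z \<in> face_ideal n (Pow ?F)" for z
  proof -
    have "keys w \<notin> faces" if "w \<in> keys (z * ?x)" for w
    proof -
      have "w \<in> (+) (set_monom ?F) ` keys z"
        using that keys_monom_poly_mult[of "set_monom ?F" z] by (simp add: mult.commute)
      then obtain v where v: "v \<in> keys z" "w = set_monom ?F + v" by blast
      have "keys v \<subseteq> {1..n}" "\<not> keys v \<subseteq> ?F" using z v(1) by (auto simp: face_ideal_def mem_polys_iff)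
      hence "?F \<union> keys v \<subseteq> {1..n}" "?F \<subset> ?F \<union> keys v" using F(1) by blast+
      hence "?F \<union> keys v \<notin> faces" by (rule small_facet)
      thus ?thesis by (simp add: v(2) keys_add_monom keys_set_monom finite_U)
    qed
    moreover have "z \<in> polys n" using z by (simp add: face_ideal_def)
    ultimately show ?thesis using polys.mult_closed[OF _ x_closed] by (simp add: face_ideal_def)
  qed
  hence rel: "(\<Sum>as\<in>A. single 0 (c as) * list_power hs as) * ?x \<in> ?I" using A(5) by blast
  have unit: "single 0 (c as) \<in> polys n \<and> (\<exists>d\<in>polys n. d * single 0 (c as) = 1)" if "as \<in> A" for as
    by (rule scalar_unit[OF A(4)[OF that]])
  have "?x \<in> polys.adjoin_list n ?I hs"
    by (rule polys.weakly_regular_relation[OF ideal_in_faces hs_closed hs_reg x_closed A(1-3) unit rel])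
  moreover have "polys.adjoin_list n ?I hs \<subseteq> degree_ideal n faces q"
  proof (rule polys.adjoin_list_least)
    show "polys.ideal_in n (degree_ideal n faces q :: 'k mpoly set)"
      by (rule ideal_in_degree_ideal[OF down_closed_faces])
    show "?I \<subseteq> degree_ideal n faces q" by (rule face_ideal_subset_degree_ideal)
    have "g ^ q \<in> degree_ideal n faces q" if "g \<in> set gs" for g
      using gs that by (intro degree_ideal_power[OF down_closed_faces]) blast
    thus "set hs \<subseteq> degree_ideal n faces q" by (auto simp: hs_def)
  qed
  ultimately have "?x \<in> degree_ideal n faces q" by blast
  hence "?F \<notin> faces \<or> q \<le> card ?F"
    by (simp add: degree_ideal_def keys_monom_poly keys_set_monom mdeg_set_monom finite_U)
  moreover have "card ?F < q" unfolding F(2) using q_pos by linarith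
  ultimately show False using small_sets_are_faces[OF F(1)] by linarith
qed

lemma depth_lexsegment:
  "depth (polynomial_ring n Quot (face_ideal n faces :: 'k::field mpoly set))
    (irrelevant_ideal n (face_ideal n faces :: 'k mpoly set)) = enat (q - 1)"
proof -
  let ?I = "face_ideal n faces :: 'k mpoly set"
  let ?R = "polynomial_ring n Quot ?I" and ?M = "degree_ideal n faces 1 :: 'k mpoly set"
  interpret Q: quotient_ring ?I "polynomial_ring n :: 'k mpoly ring"
    by (rule quotient_ring_polys[OF ideal_in_faces])
  have J: "irrelevant_ideal n ?I = Q.proj ` ?M" by (rule irrelevant_ideal_eq[OF down_closed_faces])
  have M_closed: "?M \<subseteq> polys n" by (auto simp: degree_ideal_def)
  have M: "polys.ideal_in n ?M" by (rule ideal_in_degree_ideal[OF down_closed_faces])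
  let ?P = "\<lambda>l. \<exists>fs. length fs = l \<and> set fs \<subseteq> Q.proj ` ?M \<and> regular_sequence ?R fs"
  have "Sup {enat l | l. ?P l} = enat (q - 1)"
  proof (rule Sup_enat_eqI)
    let ?es = "esyms n (q - 1) :: 'k mpoly list"
    have sub: "set ?es \<subseteq> ?M"
    proof
      fix e assume "e \<in> set ?es"
      then obtain j where j: "1 \<le> j" "e = esym n j" by (auto simp: set_esyms)
      have "homogeneous j e" "e \<in> polys n"
        unfolding j(2) by (rule homogeneous_esym, rule esym_closed)
      thus "e \<in> ?M" using j(1) by (auto simp: degree_ideal_def homogeneous_def)
    qed
    have "polys.weakly_regular n ?I ?es"
    proof (rule weakly_regular_esyms_complex)
      show "q - 1 \<le> n" using q_le_n by simp
      show "A \<in> faces" if "A \<subseteq> {1..n}" "card A \<le> q - 1" for A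
        using small_sets_are_faces[OF that(1)] that(2) q_pos by simp
      show "A \<subseteq> {1..n} \<and> card A \<le> Suc (q - 1)" if "A \<in> faces" for A
        using card_face_le[OF that] faces_subset that by auto
    qed
    moreover have "polys.adjoin_list n ?I ?es \<subseteq> ?M"
      by (rule polys.adjoin_list_least[OF M face_ideal_subset_degree_ideal sub])
    moreover have "1 \<notin> ?M"
      using small_sets_are_faces[of "{}"] q_pos by (simp add: degree_ideal_def mdeg_def)
    ultimately have "regular_sequence ?R (map Q.proj ?es)"
      using regular_sequence_Quot_iff[OF ideal_in_faces, of ?es] sub M_closed by blast
    thus "?P (q - 1)"
      using sub by (intro exI[of _ "map Q.proj ?es"]) (auto simp: length_esyms)
  next
    fix l assume "?P l"
    then obtain fs where fs: "length fs = l" "set fs \<subseteq> Q.proj ` ?M" "regular_sequence ?R fs" by blast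
    have "fs \<in> map Q.proj ` lists ?M"
      unfolding lists_image[symmetric] in_lists_conv_set using fs(2) by blast
    then obtain gs where gs: "fs = map Q.proj gs" "set gs \<subseteq> ?M"
      unfolding lists_eq_set by blast
    have "polys.weakly_regular n ?I gs"
      using regular_sequence_Quot_iff[OF ideal_in_faces, of gs] fs(3) gs M_closed by blast
    hence "length gs < q" by (rule weakly_regular_length_less[OF gs(2)])
    thus "l \<le> q - 1" using fs(1) gs(1) by simp
  qed
  moreover have "{enat (length fs) | fs. set fs \<subseteq> Q.proj ` ?M \<and> regular_sequence ?R fs} = {enat l | l. ?P l}"
    by blast
  ultimately show ?thesis unfolding depth_def J by simp
qed

text \<open>The \<open>t\<close>-th length in the definition of the multiplicity is the number of monomials of degree
  less than \<open>t\<close> that are supported on faces.\<close>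

lemma multiplicity_lexsegment:
  "hs_multiplicity (polynomial_ring n Quot (face_ideal n faces :: 'k::field mpoly set))
    (irrelevant_ideal n (face_ideal n faces :: 'k mpoly set)) = real (card {G \<in> faces. card G = q})"
proof -
  let ?I = "face_ideal n faces :: 'k mpoly set"
  let ?R = "polynomial_ring n Quot ?I" and ?J = "irrelevant_ideal n (face_ideal n faces :: 'k mpoly set)"
  interpret cring "polynomial_ring n :: 'k mpoly ring" by (rule cring_polynomial_ring)
  have fin: "finite faces" using finite_subset[OF faces_subset] by simp
  have fin': "finite G" if "G \<in> faces" for G using that faces_subset finite_vertices by blast
  have "ring_length (?R Quot ideal_power ?R ?J t) = enat (card (face_monoms faces t))" for t
  proof -
    have "ring_length (?R Quot ideal_power ?R ?J t)
        = Sup {enat l | l. ideal_chain (polynomial_ring n) (degree_ideal n faces t :: 'k mpoly set) l}"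
      unfolding ideal_power_irrelevant[OF down_closed_faces]
      using ideal_in_faces ideal_in_degree_ideal[OF down_closed_faces]
      by (intro ring_length_Quot_Quot face_ideal_subset_degree_ideal) (simp_all add: ideal_iff)
    also have "\<dots> = enat (card (face_monoms faces t))"
      using card_face_monoms(1)[OF fin fin']
      by (intro Sup_enat_eqI ideal_chain_length_le
          ideal_chain_length_ge[OF down_closed_faces faces_subset])
    finally show ?thesis .
  qed
  moreover have "(\<lambda>t. fact q * real (card (face_monoms faces t)) / real t ^ q)
      \<longlonglongrightarrow> real (card {G \<in> faces. card G = q})"
    using card_face_le fin' by (intro face_monoms_asymptotics[OF fin]) blast
  ultimately show ?thesis
    by (simp add: hs_multiplicity_def krull_dim_lexsegment limI)
qed

end

theorem corollary2p1p9:
  fixes n q :: nat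
    and i :: "nat \<Rightarrow> nat"
    and \<Delta> :: "nat set set"
    and u :: monom
    and S :: "'k::field mpoly ring"
    and I :: "'k mpoly set"
    and F :: "nat set"
  defines "S \<equiv> polynomial_ring n"
    and "u \<equiv> var_monom 1 + (\<Sum>j=2..q. var_monom (i j))"
    and "I \<equiv> Idl\<^bsub>S\<^esub> (monom_poly ` final_lexsegment n q u)"
    and "F \<equiv> i ` {2..q}"
  assumes "q \<ge> 2"
    and "strict_mono_on {2..q} i"
    and "i ` {2..q} \<subseteq> {2..n}"
    and "u \<noteq> (\<Sum>j=1..q. var_monom j)"
    and "simplicial_complex n \<Delta>"
    and "stanley_reisner_ideal n \<Delta> = I"
  shows "krull_dim (S Quot I) = enat q
    \<and> depth (S Quot I) (irrelevant_ideal n I) = enat (q - 1)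
    \<and> hs_multiplicity (stanley_reisner_ring n \<Delta> :: 'k mpoly set ring)
          (irrelevant_ideal n (stanley_reisner_ideal n \<Delta>))
        = real (card {set_monom G | G. G \<subseteq> {1..n} \<and> card G = n - q \<and>
            set_monom (({1..n} - F) - {1}) > set_monom G})"
proof -
  have inj: "inj_on i {2..q}" using assms(6) by (rule strict_mono_on_imp_inj_on)
  have F: "finite F" "F \<subseteq> {2..n}" "card F = q - 1" "1 \<notin> F"
    using assms(7) card_image[OF inj] by (auto simp: F_def)
  let ?U = "insert 1 F"
  have u: "u = set_monom ?U"
    using F by (simp add: u_def set_monom_def F_def sum.reindex[OF inj])
  have "2 \<le> n" using F(2,3) assms(5) by (cases "F = {}") auto
  interpret final_lexsegment_complex n q ?U
  proof
    show "?U \<subseteq> {1..n}" using F(2) \<open>2 \<le> n\<close> by auto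
    show "card ?U = q" using F assms(5) by simp
    show "?U \<noteq> {1..q}" using assms(8) unfolding u by (auto simp: set_monom_def)
  qed simp
  have I: "I = face_ideal n faces"
    unfolding I_def S_def u by (rule lexsegment_ideal_eq)
  have complement: "({1..n} - F) - {1} = {1..n} - ?U" by blast
  show ?thesis
    unfolding stanley_reisner_ring_def assms(10) I S_def complement card_large_facets
    by (intro conjI krull_dim_lexsegment depth_lexsegment multiplicity_lexsegment)
qed

end
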